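(* Let $n\geq r\geq1$ and let $\{A_j\}_{j=1}^m$ be a frame of Hermitian $n\times n$ matrices for $\mathbb{C}^{n\times r}$. The following are equivalent: (i) $\{A_j\}$ is generalized phase retrievable. (ii) For all $U_1\in\mathbb{C}^{n\times r},U_2\in\mathbb{C}^{n\times(n-r)}$ with $[U_1|U_2]\in U(n)$, the matrix $Q_{[U_1|U_2]}=\sum_{j=1}^mv_jv_j^T$, $v_j=\begin{bmatrix}\tau(U_1^*A_jU_1)\\\mu(U_2^*A_jU_1)\end{bmatrix}$, is invertible. (iii) For all $z\in\mathbb{C}^{n\times r}$ with orthonormal columns, the matrix $\hat Q_z=4\sum_{j=1}^m(I_r\otimes j(A_j))\mu(z)\mu(z)^T(I_r\otimes j(A_j))$ has null space exactly the $r^2$-dimensional space $\mathcal{V}_z=\{\mu(zK):K\in\mathbb{C}^{r\times r},K^*=-K\}$. (iv) For all $U_1,U_2$ as in (ii), all Hermitian $H\in\mathbb{C}^{r\times r}$ and all $B\in\mathbb{C}^{(n-r)\times r}$, there exist $c_1,\dots,c_m\in\mathbb{R}$ with $U_1^*(\sum_jc_jA_j)U_1=H$ and $U_2^*(\sum_jc_jA_j)U_1=B$. (v) For all $U_1\in\mathbb{C}^{n\times r}$ with orthonormal columns, $\mathrm{span}_{\mathbb{R}}\{A_jU_1\}_{j=1}^m=\{U_1K:K\in\mathbb{C}^{r\times r},K^*=-K\}^\perp$, the orthogonal complement in $\mathbb{C}^{n\times r}$ with respect to $\langle X,Y\rangle_{\mathbb{R}}=\mathrm{Re}\,\mathrm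{tr}(X^*Y)$.
   Context: Frame: there are $0<A\le B$ with $A\|z\|_2^2\leq\sum_j\mathrm{Re}\,\mathrm{tr}(A_jzz^* )\leq B\|z\|_2^2$ for all $z\in\mathbb{C}^{n\times r}$. Generalized phase retrievable: the map $\beta(z)=(\mathrm{Re}\,\mathrm{tr}(A_jzz^* ))_{j=1}^m$ satisfies $\beta(x)=\beta(y)\Rightarrow xx^*=yy^*$ (i.e. is injective on $\mathbb{C}^{n\times r}/U(r)$). $\tau(X)=(X_{11},\dots,X_{rr},\sqrt2\,T(\mathrm{Re}X),\sqrt2\,T(\mathrm{Im}X))\in\mathbb{R}^{r^2}$ for Hermitian $r\times r$ $X$, where $T(Y)=(Y_{12},Y_{13},Y_{23},\dots,Y_{r-1,r})$; $\mu(X)=\mathrm{vec}\begin{bmatrix}\mathrm{Re}X\\\mathrm{Im}X\end{bmatrix}$ (column stacking) for complex $p\times q$ $X$; $j(X)=\begin{bmatrix}\mathrm{Re}X&-\mathrm{Im}X\\\mathrm{Im}X&\mathrm{Re}X\end{bmatrix}$. *)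

theory Defs
  imports Complex_Main "Jordan_Normal_Form.Matrix"
begin

definition adj :: "complex mat \<Rightarrow> complex mat" where
  "adj A = mat (dim_col A) (dim_row A) (\<lambda>(i,j). cnj (A $$ (j,i)))"

definition ctrace :: "complex mat \<Rightarrow> complex" where
  "ctrace A = (\<Sum>i<dim_row A. A $$ (i,i))"

definition hermitian_mat :: "nat \<Rightarrow> complex mat \<Rightarrow> bool" where
  "hermitian_mat n A \<longleftrightarrow> A \<in> carrier_mat n n \<and> adj A = A"

definition skew_hermitian_mat :: "nat \<Rightarrow> complex mat \<Rightarrow> bool" where
  "skew_hermitian_mat n K \<longleftrightarrow> K \<in> carrier_mat n n \<and> adj K = - K"

definition unitary_mat :: "nat \<Rightarrow> complex mat \<Rightarrow> bool" where
  "unitary_mat n U \<longleftrightarrow> U \<in> carrier_mat n n \<and> adj U * U = 1\<^sub>m n \<and> U * adj U = 1\<^sub>m n"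

definition orthonormal_cols :: "nat \<Rightarrow> nat \<Rightarrow> complex mat \<Rightarrow> bool" where
  "orthonormal_cols n r z \<longleftrightarrow> z \<in> carrier_mat n r \<and> adj z * z = 1\<^sub>m r"

definition hcat :: "complex mat \<Rightarrow> complex mat \<Rightarrow> complex mat" where
  "hcat U1 U2 = mat (dim_row U1) (dim_col U1 + dim_col U2)
     (\<lambda>(i,j). if j < dim_col U1 then U1 $$ (i,j) else U2 $$ (i, j - dim_col U1))"

definition fro_sq :: "complex mat \<Rightarrow> real" where
  "fro_sq z = (\<Sum>i<dim_row z. \<Sum>k<dim_col z. (cmod (z $$ (i,k)))\<^sup>2)"

definition rinner :: "complex mat \<Rightarrow> complex mat \<Rightarrow> real" where
  "rinner X Y = Re (ctrace (adj X * Y))"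

definition is_frame :: "nat \<Rightarrow> nat \<Rightarrow> nat \<Rightarrow> (nat \<Rightarrow> complex mat) \<Rightarrow> bool" where
  "is_frame n r m A \<longleftrightarrow> (\<exists>a b::real. 0 < a \<and> a \<le> b \<and>
     (\<forall>z \<in> carrier_mat n r.
        a * fro_sq z \<le> (\<Sum>j<m. Re (ctrace (A j * z * adj z))) \<and>
        (\<Sum>j<m. Re (ctrace (A j * z * adj z))) \<le> b * fro_sq z))"

definition beta_map :: "nat \<Rightarrow> (nat \<Rightarrow> complex mat) \<Rightarrow> complex mat \<Rightarrow> nat \<Rightarrow> real" where
  "beta_map m A z = (\<lambda>j. if j < m then Re (ctrace (A j * z * adj z)) else 0)"

definition gen_phase_retrievable :: "nat \<Rightarrow> nat \<Rightarrow> nat \<Rightarrow> (nat \<Rightarrow> complex mat) \<Rightarrow> bool" where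
  "gen_phase_retrievable n r m A \<longleftrightarrow>
     (\<forall>x \<in> carrier_mat n r. \<forall>y \<in> carrier_mat n r.
        beta_map m A x = beta_map m A y \<longrightarrow> x * adj x = y * adj y)"

text \<open>T(Y) = (Y_12, Y_13, Y_23, ..., Y_{r-1,r}) (strict upper triangle, ordered by column),
  indices shifted to start at 0.\<close>
definition upper_list :: "complex mat \<Rightarrow> complex list" where
  "upper_list X = concat (map (\<lambda>j. map (\<lambda>i. X $$ (i,j)) [0..<j]) [0..<dim_row X])"

definition tau :: "complex mat \<Rightarrow> real list" where
  "tau X = map (\<lambda>i. Re (X $$ (i,i))) [0..<dim_row X]
         @ map (\<lambda>x. sqrt 2 * Re x) (upper_list X)
         @ map (\<lambda>x. sqrt 2 * Im x) (upper_list X)"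

text \<open>mu(X) = vec [Re X; Im X] with column stacking.\<close>
definition mu :: "complex mat \<Rightarrow> real list" where
  "mu X = concat (map (\<lambda>k. map (\<lambda>i. Re (X $$ (i,k))) [0..<dim_row X]
                           @ map (\<lambda>i. Im (X $$ (i,k))) [0..<dim_row X]) [0..<dim_col X])"

definition jmat :: "complex mat \<Rightarrow> real mat" where
  "jmat X = mat (2 * dim_row X) (2 * dim_col X) (\<lambda>(i,k).
      if i < dim_row X then
        (if k < dim_col X then Re (X $$ (i,k)) else - Im (X $$ (i, k - dim_col X)))
      else
        (if k < dim_col X then Im (X $$ (i - dim_row X, k)) else Re (X $$ (i - dim_row X, k - dim_col X))))"

definition kron_id :: "nat \<Rightarrow> real mat \<Rightarrow> real mat" where
  "kron_id r M = mat (r * dim_row M) (r * dim_col M) (\<lambda>(a,b).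
      if a div dim_row M = b div dim_col M then M $$ (a mod dim_row M, b mod dim_col M) else 0)"

definition outer :: "real list \<Rightarrow> real mat" where
  "outer v = mat (length v) (length v) (\<lambda>(a,b). v ! a * v ! b)"

definition Qmat :: "nat \<Rightarrow> (nat \<Rightarrow> complex mat) \<Rightarrow> complex mat \<Rightarrow> complex mat \<Rightarrow> real mat" where
  "Qmat m A U1 U2 = (let d = (dim_col U1)\<^sup>2 + 2 * dim_col U2 * dim_col U1 in
     mat d d (\<lambda>ab. \<Sum>j<m. outer (tau (adj U1 * A j * U1) @ mu (adj U2 * A j * U1)) $$ ab))"

definition Qhat :: "nat \<Rightarrow> (nat \<Rightarrow> complex mat) \<Rightarrow> complex mat \<Rightarrow> real mat" where
  "Qhat m A z = (let N = 2 * dim_row z * dim_col z in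
     mat N N (\<lambda>ab. 4 * (\<Sum>j<m.
        (kron_id (dim_col z) (jmat (A j)) * outer (mu z) * kron_id (dim_col z) (jmat (A j))) $$ ab)))"

definition null_space :: "real mat \<Rightarrow> real vec set" where
  "null_space M = {v \<in> carrier_vec (dim_col M). M *\<^sub>v v = 0\<^sub>v (dim_row M)}"

definition Vz :: "complex mat \<Rightarrow> real vec set" where
  "Vz z = {vec_of_list (mu (z * K)) | K. skew_hermitian_mat (dim_col z) K}"

definition lincomb :: "nat \<Rightarrow> nat \<Rightarrow> (nat \<Rightarrow> real) \<Rightarrow> (nat \<Rightarrow> complex mat) \<Rightarrow> complex mat" where
  "lincomb n m c A = mat n n (\<lambda>ab. \<Sum>j<m. complex_of_real (c j) * A j $$ ab)"

definition real_span_AU :: "nat \<Rightarrow> (nat \<Rightarrow> complex mat) \<Rightarrow> complex mat \<Rightarrow> complex mat set" where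
  "real_span_AU m A U1 = {mat (dim_row U1) (dim_col U1)
       (\<lambda>ab. \<Sum>j<m. complex_of_real (c j) * (A j * U1) $$ ab) | c. True}"

definition orth_compl :: "nat \<Rightarrow> nat \<Rightarrow> complex mat set \<Rightarrow> complex mat set" where
  "orth_compl n r S = {X \<in> carrier_mat n r. \<forall>Y \<in> S. rinner X Y = 0}"

end

theory Submission
  imports Defs "Jordan_Normal_Form.Determinant"
begin

text \<open>
  Write \<open>x = u + v\<close>, \<open>y = u - v\<close>. Then \<open>\<beta>(x) = \<beta>(y)\<close> means \<open>\<langle>u, A\<^sub>j v\<rangle> = 0\<close> for all \<open>j\<close>, and
  \<open>xx\<^sup>* = yy\<^sup>*\<close> means \<open>uv\<^sup>* + vu\<^sup>* = 0\<close>. A QR factorisation \<open>u = UR\<close>, which exists even if \<open>u\<close> is rank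
  deficient, gives \<open>uv\<^sup>* = U(vR\<^sup>*)\<^sup>*\<close>, so \<open>u\<close> may be taken to have orthonormal columns; and then
  \<open>Uv\<^sup>* + vU\<^sup>* = 0\<close> says exactly that \<open>v = UK\<close> with \<open>K\<close> skew-Hermitian. Hence phase retrievability
  is the condition that the orthogonal complement of \<open>span {A\<^sub>j U}\<close> is \<open>{UK. K\<^sup>* = -K}\<close> for every
  \<open>U\<close> with orthonormal columns. Since \<open>\<tau>\<close> and \<open>\<mu>\<close> are isometries onto real coordinate
  spaces, the other conditions restate this one in the coordinates
  \<open>W = U\<^sub>1 H + U\<^sub>2 B\<close>: a Gram matrix \<open>\<Sum>\<^sub>j v\<^sub>j v\<^sub>j\<^sup>T\<close> has kernel \<open>{v\<^sub>j}\<^sup>\<bottom>\<close> and range \<open>span {v\<^sub>j}\<close>.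
\<close>

section \<open>Adjoints and the real inner product\<close>

lemma index_mult_sum:
  fixes A B :: "'a::semiring_0 mat"
  assumes "A \<in> carrier_mat p q" "B \<in> carrier_mat q s" "i < p" "j < s"
  shows "(A * B) $$ (i,j) = (\<Sum>l<q. A $$ (i,l) * B $$ (l,j))"
  using assms by (simp add: scalar_prod_def atLeast0LessThan)

lemma adj_carrier [simp]: "A \<in> carrier_mat p q \<Longrightarrow> adj A \<in> carrier_mat q p"
  by (auto simp: adj_def)

lemma adj_dim [simp]: "dim_row (adj A) = dim_col A" "dim_col (adj A) = dim_row A"
  by (auto simp: adj_def)

lemma adj_index [simp]: "i < dim_col A \<Longrightarrow> j < dim_row A \<Longrightarrow> adj A $$ (i,j) = cnj (A $$ (j,i))"
  by (auto simp: adj_def)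

lemma adj_adj [simp]: "adj (adj A) = A"
  by (rule eq_matI) auto

lemma adj_minus: "A \<in> carrier_mat p q \<Longrightarrow> B \<in> carrier_mat p q \<Longrightarrow> adj (A - B) = adj A - adj B"
  by (rule eq_matI) auto

lemma adj_uminus: "adj (- A) = - adj A"
  by (rule eq_matI) auto

lemma adj_mult:
  assumes "A \<in> carrier_mat p q" "B \<in> carrier_mat q s"
  shows "adj (A * B) = adj B * adj A"
proof (rule eq_matI)
  fix i j assume "i < dim_row (adj B * adj A)" "j < dim_col (adj B * adj A)"
  then have ij: "i < s" "j < p" using assms by auto
  have "adj (A * B) $$ (i,j) = cnj ((A * B) $$ (j,i))" using assms ij by (subst adj_index) auto
  also have "\<dots> = (\<Sum>l<q. cnj (A $$ (j,l)) * cnj (B $$ (l,i)))"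
    using index_mult_sum[OF assms ij(2,1)] by simp
  also have "\<dots> = (\<Sum>l<q. adj B $$ (i,l) * adj A $$ (l,j))"
    using assms ij by (intro sum.cong) auto
  also have "\<dots> = (adj B * adj A) $$ (i,j)"
    using index_mult_sum[of "adj B" s q "adj A" p] assms ij by simp
  finally show "adj (A * B) $$ (i,j) = (adj B * adj A) $$ (i,j)" .
qed (use assms in auto)

lemma ctrace_mult_comm:
  assumes "A \<in> carrier_mat p q" "B \<in> carrier_mat q p"
  shows "ctrace (A * B) = ctrace (B * A)"
proof -
  have "ctrace (A * B) = (\<Sum>i<p. \<Sum>l<q. A $$ (i,l) * B $$ (l,i))"
    using assms index_mult_sum[OF assms] by (simp add: ctrace_def del: index_mult_mat(1))
  also have "\<dots> = (\<Sum>l<q. \<Sum>i<p. B $$ (l,i) * A $$ (i,l))"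
    by (subst sum.swap) (simp add: mult.commute)
  also have "\<dots> = ctrace (B * A)"
    using assms index_mult_sum[OF assms(2,1)] by (simp add: ctrace_def del: index_mult_mat(1))
  finally show ?thesis .
qed

lemma rinner_sum:
  assumes "X \<in> carrier_mat p q" "Y \<in> carrier_mat p q"
  shows "rinner X Y = (\<Sum>k<q. \<Sum>i<p. Re (X $$ (i,k)) * Re (Y $$ (i,k)) + Im (X $$ (i,k)) * Im (Y $$ (i,k)))"
proof -
  have "ctrace (adj X * Y) = (\<Sum>k<q. \<Sum>i<p. cnj (X $$ (i,k)) * Y $$ (i,k))"
    using assms index_mult_sum[of "adj X" q p Y q] by (simp add: ctrace_def del: index_mult_mat(1))
  then show ?thesis by (simp add: rinner_def)
qed

lemma rinner_commute:
  assumes "X \<in> carrier_mat p q" "Y \<in> carrier_mat p q"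
  shows "rinner X Y = rinner Y X"
  using assms by (simp add: rinner_sum mult.commute)

lemma rinner_add_right:
  assumes "X \<in> carrier_mat p q" "Y \<in> carrier_mat p q" "Z \<in> carrier_mat p q"
  shows "rinner X (Y + Z) = rinner X Y + rinner X Z"
proof -
  have "rinner X (Y + Z) = (\<Sum>k<q. \<Sum>i<p. (Re (X $$ (i,k)) * Re (Y $$ (i,k)) + Im (X $$ (i,k)) * Im (Y $$ (i,k)))
     + (Re (X $$ (i,k)) * Re (Z $$ (i,k)) + Im (X $$ (i,k)) * Im (Z $$ (i,k))))"
    unfolding rinner_sum[OF assms(1) add_carrier_mat[OF assms(3)], of Y]
    using assms by (intro sum.cong refl) (auto simp: algebra_simps)
  also have "\<dots> = rinner X Y + rinner X Z"
    using assms by (simp only: rinner_sum sum.distrib)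
  finally show ?thesis .
qed

lemma rinner_uminus_right:
  assumes "X \<in> carrier_mat p q" "Y \<in> carrier_mat p q"
  shows "rinner X (- Y) = - rinner X Y"
proof -
  have "rinner X (- Y) = (\<Sum>k<q. \<Sum>i<p. - (Re (X $$ (i,k)) * Re (Y $$ (i,k)) + Im (X $$ (i,k)) * Im (Y $$ (i,k))))"
    unfolding rinner_sum[OF assms(1) uminus_carrier_mat[OF assms(2)]]
    using assms by (intro sum.cong refl) auto
  also have "\<dots> = - rinner X Y"
    using assms by (simp only: rinner_sum sum_negf)
  finally show ?thesis .
qed

lemma rinner_minus_right:
  assumes "X \<in> carrier_mat p q" "Y \<in> carrier_mat p q" "Z \<in> carrier_mat p q"
  shows "rinner X (Y - Z) = rinner X Y - rinner X Z"
  using rinner_add_right[OF assms(1,2), of "- Z"] rinner_uminus_right[OF assms(1,3)] assms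
  by (simp add: add_uminus_minus_mat[of Y p q])

lemma rinner_add_left:
  assumes "X \<in> carrier_mat p q" "Y \<in> carrier_mat p q" "Z \<in> carrier_mat p q"
  shows "rinner (Y + Z) X = rinner Y X + rinner Z X"
  using assms rinner_add_right[OF assms] rinner_commute[of _ p q X] by simp

lemma rinner_minus_left:
  assumes "X \<in> carrier_mat p q" "Y \<in> carrier_mat p q" "Z \<in> carrier_mat p q"
  shows "rinner (Y - Z) X = rinner Y X - rinner Z X"
  using assms rinner_minus_right[OF assms] rinner_commute[of _ p q X]
  by (simp add: minus_carrier_mat[OF assms(3)])

lemma rinner_combination:
  assumes "X \<in> carrier_mat p q" "\<And>j. j < m \<Longrightarrow> Y j \<in> carrier_mat p q"
  shows "rinner X (mat p q (\<lambda>ab. \<Sum>j<m. complex_of_real (c j) * Y j $$ ab)) = (\<Sum>j<m. c j * rinner X (Y j))"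
proof -
  have "rinner X (mat p q (\<lambda>ab. \<Sum>j<m. complex_of_real (c j) * Y j $$ ab)) =
    (\<Sum>k<q. \<Sum>i<p. \<Sum>j<m. c j * (Re (X $$ (i,k)) * Re (Y j $$ (i,k)) + Im (X $$ (i,k)) * Im (Y j $$ (i,k))))"
    unfolding rinner_sum[OF assms(1) mat_carrier]
    by (intro sum.cong refl) (simp add: sum_distrib_left sum.distrib algebra_simps)
  also have "\<dots> = (\<Sum>k<q. \<Sum>j<m. \<Sum>i<p. c j * (Re (X $$ (i,k)) * Re (Y j $$ (i,k)) + Im (X $$ (i,k)) * Im (Y j $$ (i,k))))"
    by (intro sum.cong refl sum.swap)
  also have "\<dots> = (\<Sum>j<m. \<Sum>k<q. \<Sum>i<p. c j * (Re (X $$ (i,k)) * Re (Y j $$ (i,k)) + Im (X $$ (i,k)) * Im (Y j $$ (i,k))))"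
    by (rule sum.swap)
  also have "\<dots> = (\<Sum>j<m. c j * rinner X (Y j))"
    using assms by (intro sum.cong refl) (simp add: rinner_sum[OF assms(1)] sum_distrib_left)
  finally show ?thesis .
qed

lemma rinner_mult_left:
  assumes "A \<in> carrier_mat p q" "X \<in> carrier_mat q s" "Y \<in> carrier_mat p s"
  shows "rinner (A * X) Y = rinner X (adj A * Y)"
  unfolding rinner_def using assms by (simp add: adj_mult[OF assms(1,2)] assoc_mult_mat[of _ s q _ p _ s])

text \<open>Cyclicity of the trace carries \<open>adj R\<close> from the left of
  \<open>adj X * Y\<close> to its right.\<close>

lemma rinner_mult_right:
  assumes "X \<in> carrier_mat p q" "R \<in> carrier_mat q s" "Y \<in> carrier_mat p s"
  shows "rinner (X * R) Y = rinner X (Y * adj R)"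
proof -
  have "ctrace (adj R * (adj X * Y)) = ctrace (adj X * Y * adj R)"
    by (rule ctrace_mult_comm[of _ s q]) (use assms in auto)
  then show ?thesis
    unfolding rinner_def using assms
    by (simp add: adj_mult[OF assms(1,2)] assoc_mult_mat[of _ s q _ p _ s] assoc_mult_mat[of _ q p _ s _ q])
qed

text \<open>Transposition only reindexes the double sum, and conjugation flips the signs of both
  imaginary parts, so every product survives.\<close>

lemma rinner_adj:
  assumes "X \<in> carrier_mat p q" "Y \<in> carrier_mat p q"
  shows "rinner (adj X) (adj Y) = rinner X Y"
proof -
  have "rinner (adj X) (adj Y) = (\<Sum>k<p. \<Sum>i<q. Re (X $$ (k,i)) * Re (Y $$ (k,i)) + Im (X $$ (k,i)) * Im (Y $$ (k,i)))"
    unfolding rinner_sum[OF adj_carrier[OF assms(1)] adj_carrier[OF assms(2)]]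
    using assms by (intro sum.cong refl) auto
  also have "\<dots> = rinner X Y"
    unfolding rinner_sum[OF assms] by (rule sum.swap)
  finally show ?thesis .
qed

lemma rinner_zero_right [simp]: "X \<in> carrier_mat p q \<Longrightarrow> rinner X (0\<^sub>m p q) = 0"
  by (simp add: rinner_sum)

lemma rinner_self_eq_0:
  assumes "X \<in> carrier_mat p q" "rinner X X = 0"
  shows "X = 0\<^sub>m p q"
proof (rule eq_matI)
  fix i k assume "i < dim_row (0\<^sub>m p q)" "k < dim_col (0\<^sub>m p q)"
  then have ik: "i < p" "k < q" by auto
  have "(\<Sum>i<p. Re (X $$ (i,k)) * Re (X $$ (i,k)) + Im (X $$ (i,k)) * Im (X $$ (i,k))) = 0"
    using assms(2) ik unfolding rinner_sum[OF assms(1,1)]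
    by (subst (asm) sum_nonneg_eq_0_iff) (auto intro: sum_nonneg)
  then have "Re (X $$ (i,k)) * Re (X $$ (i,k)) + Im (X $$ (i,k)) * Im (X $$ (i,k)) = 0"
    using ik by (subst (asm) sum_nonneg_eq_0_iff) auto
  then show "X $$ (i,k) = 0\<^sub>m p q $$ (i,k)"
    using ik by (simp add: complex_eq_iff)
qed (use assms in auto)

text \<open>Taking adjoints preserves \<open>rinner\<close> but sends the pair \<open>H\<close>,
  \<open>K\<close> to \<open>H\<close>, \<open>- K\<close>, so the value equals its own
  negative.\<close>

lemma rinner_skew_hermitian_mat:
  assumes "hermitian_mat r H" "skew_hermitian_mat r K"
  shows "rinner H K = 0"
proof -
  have c: "H \<in> carrier_mat r r" "K \<in> carrier_mat r r" "adj H = H" "adj K = - K"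
    using assms by (auto simp: hermitian_mat_def skew_hermitian_mat_def)
  have "rinner H K = - rinner H K"
    using rinner_adj[OF c(1,2)] rinner_uminus_right[OF c(1,2)] c by simp
  then show ?thesis by simp
qed

section \<open>Orthonormal columns\<close>

text \<open>If no basis vector had a component orthogonal to all \<open>q i\<close>, then
  \<open>\<Sum>i. q i (q i)\<^sup>*\<close> would be the identity; comparing traces gives \<open>k = n\<close>.\<close>
lemma exists_nonzero_residual:
  fixes q :: "nat \<Rightarrow> nat \<Rightarrow> complex"
  assumes q: "\<And>i j. i < k \<Longrightarrow> j < k \<Longrightarrow> (\<Sum>a<n. cnj (q i a) * q j a) = (if i = j then 1 else 0)"
    and "k < n"
  shows "\<exists>x. \<exists>a<n. x a - (\<Sum>i<k. (\<Sum>b<n. cnj (q i b) * x b) * q i a) \<noteq> 0"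
proof (rule ccontr)
  assume "\<not> ?thesis"
  then have *: "x a = (\<Sum>i<k. (\<Sum>b<n. cnj (q i b) * x b) * q i a)" if "a < n" for x a
    using that by force
  have "(\<Sum>i<k. cnj (q i a) * q i a) = 1" if a: "a < n" for a
  proof -
    have "(\<Sum>b<n. cnj (q i b) * (if b = a then 1 else 0)) = cnj (q i a)" for i
      using a by (simp add: if_distrib cong: if_cong)
    then show ?thesis using *[OF a, of "\<lambda>b. if b = a then 1 else 0"] by simp
  qed
  then have "of_nat n = (\<Sum>a<n. \<Sum>i<k. cnj (q i a) * q i a)" by simp
  also have "\<dots> = (\<Sum>i<k. \<Sum>a<n. cnj (q i a) * q i a)" by (rule sum.swap)
  also have "\<dots> = of_nat k" using q by simp
  finally show False using \<open>k < n\<close> by (simp del: sum_constant)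
qed

text \<open>A Gram-Schmidt step that cannot break down: if \<open>w\<close> already lies in the span
  of the \<open>q i\<close>, the new unit vector comes from some other vector with nonzero residual,
  and \<open>w\<close> has coefficient zero on it.\<close>

lemma orthonormal_step:
  fixes q :: "nat \<Rightarrow> nat \<Rightarrow> complex"
  assumes q: "\<And>i j. i < k \<Longrightarrow> j < k \<Longrightarrow> (\<Sum>a<n. cnj (q i a) * q j a) = (if i = j then 1 else 0)"
    and "k < n"
  obtains p c d where "(\<Sum>a<n. cnj (p a) * p a) = 1" "\<And>i. i < k \<Longrightarrow> (\<Sum>a<n. cnj (q i a) * p a) = 0"
    "\<And>a. a < n \<Longrightarrow> w a = (\<Sum>i<k. c i * q i a) + d * p a"
proof -
  define pr where "pr x a = x a - (\<Sum>i<k. (\<Sum>b<n. cnj (q i b) * x b) * q i a)" for x a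
  have orth: "(\<Sum>a<n. cnj (q j a) * pr x a) = 0" if j: "j < k" for j x
  proof -
    have "(\<Sum>a<n. cnj (q j a) * pr x a) = (\<Sum>a<n. cnj (q j a) * x a)
        - (\<Sum>a<n. \<Sum>i<k. (\<Sum>b<n. cnj (q i b) * x b) * (cnj (q j a) * q i a))"
      by (simp add: pr_def algebra_simps sum_subtractf sum_distrib_left)
    also have "(\<Sum>a<n. \<Sum>i<k. (\<Sum>b<n. cnj (q i b) * x b) * (cnj (q j a) * q i a))
        = (\<Sum>i<k. \<Sum>a<n. (\<Sum>b<n. cnj (q i b) * x b) * (cnj (q j a) * q i a))"
      by (rule sum.swap)
    also have "\<dots> = (\<Sum>i<k. (\<Sum>b<n. cnj (q i b) * x b) * (if j = i then 1 else 0))"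
      using q j by (simp add: sum_distrib_left[symmetric])
    also have "\<dots> = (\<Sum>b<n. cnj (q j b) * x b)"
      using j by (simp add: if_distrib cong: if_cong)
    finally show ?thesis by simp
  qed
  \<comment> \<open>If the residual of \<open>w\<close> is nonzero, \<open>x\<close> is
    \<open>w\<close> itself and \<open>t = 1\<close>. Otherwise \<open>t = 0\<close>, and
    \<open>x\<close> is supplied by the trace argument of
    \<open>exists_nonzero_residual\<close>.\<close>
  obtain x t where x: "\<exists>a<n. pr x a \<noteq> 0" and t: "\<And>a. a < n \<Longrightarrow> pr w a = t * pr x a"
  proof (cases "\<exists>a<n. pr w a \<noteq> 0")
    case True
    then show ?thesis using that[of w 1] by auto
  next
    case False
    then show ?thesis using that[of _ 0] exists_nonzero_residual[OF q \<open>k < n\<close>] unfolding pr_def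
      by auto
  qed
  define N where "N = (\<Sum>a<n. (cmod (pr x a))\<^sup>2)"
  have "N > 0"
  proof -
    obtain a where "a < n" "pr x a \<noteq> 0" using x by blast
    then show ?thesis unfolding N_def by (intro sum_pos2[of _ a]) auto
  qed
  define s where "s = complex_of_real (sqrt N)"
  have s: "s \<noteq> 0" "s * s = of_real N" "cnj s = s" using \<open>N > 0\<close>
    by (auto simp: s_def simp flip: of_real_mult)
  \<comment> \<open>Normalising by \<open>s\<close> moves a factor into the last coefficient: the
    residual of \<open>w\<close> is \<open>t * s\<close> times \<open>pr x / s\<close>.\<close>
  show ?thesis
  proof (rule that[of "\<lambda>a. pr x a / s" "\<lambda>i. \<Sum>b<n. cnj (q i b) * w b" "t * s"])
    have "(\<Sum>a<n. cnj (pr x a / s) * (pr x a / s)) = (\<Sum>a<n. of_real ((cmod (pr x a))\<^sup>2) / of_real N)"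
      using s complex_norm_square by (intro sum.cong refl) (simp add: mult.commute del: of_real_power)
    also have "\<dots> = of_real N / of_real N"
      unfolding N_def of_real_sum sum_divide_distrib ..
    finally show "(\<Sum>a<n. cnj (pr x a / s) * (pr x a / s)) = 1" using \<open>N > 0\<close> by simp
    show "(\<Sum>a<n. cnj (q i a) * (pr x a / s)) = 0" if "i < k" for i
      using orth[OF that, of x] by (simp add: sum_divide_distrib[symmetric])
    show "w a = (\<Sum>i<k. (\<Sum>b<n. cnj (q i b) * w b) * q i a) + t * s * (pr x a / s)" if "a < n" for a
      using t[OF that] s(1) unfolding pr_def[of w] by (simp add: algebra_simps)
  qed
qed

text \<open>Iterated Gram-Schmidt with two uses: from \<open>k = 0\<close> it factors the given
  vectors \<open>w i\<close>, and from the columns of a matrix it completes them to a larger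
  orthonormal family. Only the expansion of each \<open>w i\<close> in the final family is kept;
  triangularity of \<open>C\<close> is not recorded.\<close>

lemma orthonormal_extend:
  fixes q w :: "nat \<Rightarrow> nat \<Rightarrow> complex"
  assumes "k \<le> l" "l \<le> n"
    and q: "\<forall>i<k. \<forall>j<k. (\<Sum>a<n. cnj (q i a) * q j a) = (if i = j then 1 else 0)"
  shows "\<exists>p C. (\<forall>i<l. \<forall>j<l. (\<Sum>a<n. cnj (p i a) * p j a) = (if i = j then 1 else 0)) \<and>
    (\<forall>i<k. p i = q i) \<and> (\<forall>i<l. k \<le> i \<longrightarrow> (\<forall>a<n. w i a = (\<Sum>s<l. C i s * p s a)))"
  using assms(1,2)
proof (induction l rule: dec_induct)
  case base
  then show ?case using q by (intro exI[of _ q]) auto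
next
  case (step l)
  from step.IH step.prems obtain p C where p': "\<forall>i<l. \<forall>j<l. (\<Sum>a<n. cnj (p i a) * p j a) = (if i = j then 1 else 0)"
    "\<forall>i<k. p i = q i" "\<forall>i<l. k \<le> i \<longrightarrow> (\<forall>a<n. w i a = (\<Sum>s<l. C i s * p s a))"
    by (elim impE exE conjE meta_impE) (use Suc_leD in blast)+
  note p = p'[rule_format]
  obtain v c d where v: "(\<Sum>a<n. cnj (v a) * v a) = 1" "\<And>i. i < l \<Longrightarrow> (\<Sum>a<n. cnj (p i a) * v a) = 0"
    "\<And>a. a < n \<Longrightarrow> w l a = (\<Sum>i<l. c i * p i a) + d * v a"
    using orthonormal_step[where w = "w l", OF p(1)] Suc_le_lessD[OF step.prems] by blast
  have v2: "(\<Sum>a<n. cnj (v a) * p i a) = 0" if "i < l" for i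
  proof -
    have "(\<Sum>a<n. cnj (v a) * p i a) = cnj (\<Sum>a<n. cnj (p i a) * v a)"
      by (simp add: mult.commute)
    then show ?thesis using v(2)[OF that] by simp
  qed
  \<comment> \<open>The value \<open>C i l\<close> of an old row was unconstrained so far; it
    becomes zero, so that the new vector does not enter the old expansions.\<close>
  let ?p = "p(l := v)" and ?C = "\<lambda>i. if i = l then c(l := d) else (C i)(l := 0)"
  have p_below: "(\<Sum>s<l. x s * ?p s a) = (\<Sum>s<l. x s * p s a)" for x a
    by (intro sum.cong) auto
  have C_below: "(\<Sum>s<l. (x(l := y)) s * p s a) = (\<Sum>s<l. x s * p s a)" for x y a
    by (intro sum.cong) auto
  have e1: "(\<Sum>a<n. cnj (?p i a) * ?p j a) = (if i = j then 1 else 0)" if "i < Suc l" "j < Suc l" for i j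
    using that p(1)[of i j] v(1) v(2)[of i] v2[of j] by (auto simp: less_Suc_eq)
  have e2: "?p i = q i" if "i < k" for i
    using that p(2) step.hyps by auto
  have e3: "w i a = (\<Sum>s<Suc l. ?C i s * ?p s a)" if "i < Suc l" "k \<le> i" "a < n" for i a
  proof (cases "i = l")
    case True
    then show ?thesis using v(3)[OF that(3)] by (simp add: p_below C_below)
  next
    case False
    then show ?thesis using p(3)[of i a] that by (simp add: p_below C_below)
  qed
  show ?case
    by (intro exI[of _ ?p] exI[of _ ?C] conjI allI impI) (rule e1 e2 e3; assumption)+
qed

lemma orthonormal_colsD:
  assumes "orthonormal_cols n r z"
  shows "z \<in> carrier_mat n r" "adj z * z = 1\<^sub>m r"
  using assms by (auto simp: orthonormal_cols_def)

lemma orthonormal_cols_iff: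
  assumes "z \<in> carrier_mat n r"
  shows "orthonormal_cols n r z \<longleftrightarrow>
    (\<forall>i<r. \<forall>j<r. (\<Sum>a<n. cnj (z $$ (a,i)) * z $$ (a,j)) = (if i = j then 1 else 0))"
proof -
  have "(adj z * z) $$ (i,j) = (\<Sum>a<n. cnj (z $$ (a,i)) * z $$ (a,j))" if "i < r" "j < r" for i j
    using index_mult_sum[of "adj z" r n z r i j] assms that by simp
  then show ?thesis
    using assms by (simp add: orthonormal_cols_def mat_eq_iff del: index_mult_mat(1))
qed

text \<open>Dependent columns cause no trouble: \<open>orthonormal_step\<close> then supplies a
  fresh unit vector, so \<open>U\<close> always has \<open>r\<close> orthonormal columns and the
  rank deficiency is carried by \<open>R\<close>.\<close>

lemma qr_decomposition:
  assumes "u \<in> carrier_mat n r" "r \<le> n"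
  obtains U R where "orthonormal_cols n r U" "R \<in> carrier_mat r r" "u = U * R"
proof -
  \<comment> \<open>With \<open>k = 0\<close> the initial family is empty, hence the
    \<open>undefined\<close>; the columns of \<open>u\<close> are the vectors to expand.\<close>
  obtain p C where p: "\<forall>i<r. \<forall>j<r. (\<Sum>a<n. cnj (p i a) * p j a) = (if i = j then 1 else 0)"
    and C: "\<forall>i<r. \<forall>a<n. u $$ (a,i) = (\<Sum>s<r. C i s * p s a)"
    using orthonormal_extend[of 0 r n undefined "\<lambda>i a. u $$ (a,i)"] assms by auto
  define U R where "U = mat n r (\<lambda>(a,i). p i a)" and "R = mat r r (\<lambda>(s,i). C i s)"
  show ?thesis
  proof
    show "orthonormal_cols n r U"
      using p by (subst orthonormal_cols_iff) (auto simp: U_def)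
    show "R \<in> carrier_mat r r" by (simp add: R_def)
    show "u = U * R"
    proof (rule eq_matI)
      fix a i assume "a < dim_row (U * R)" "i < dim_col (U * R)"
      then have ai: "a < n" "i < r" by (auto simp: U_def R_def)
      have "(U * R) $$ (a,i) = (\<Sum>s<r. U $$ (a,s) * R $$ (s,i))"
        by (rule index_mult_sum[OF _ _ ai]) (auto simp: U_def R_def)
      also have "\<dots> = u $$ (a,i)"
        using C ai by (auto simp: U_def R_def mult.commute intro!: sum.cong)
      finally show "u $$ (a,i) = (U * R) $$ (a,i)" by simp
    qed (use assms in \<open>auto simp: U_def R_def\<close>)
  qed
qed

section \<open>Unitary completions and their block identities\<close>

lemma unitary_mat_iff_orthonormal_cols: "unitary_mat n U \<longleftrightarrow> orthonormal_cols n n U"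
  using mat_mult_left_right_inverse[of "adj U" n U]
  by (auto simp: unitary_mat_def orthonormal_cols_def)

lemma hcat_carrier:
  "U1 \<in> carrier_mat n r \<Longrightarrow> U2 \<in> carrier_mat n s \<Longrightarrow> hcat U1 U2 \<in> carrier_mat n (r + s)"
  by (auto simp: hcat_def)

lemma orthonormal_cols_complete:
  assumes "orthonormal_cols n r U1" "r \<le> n"
  obtains U2 where "U2 \<in> carrier_mat n (n - r)" "unitary_mat n (hcat U1 U2)"
proof -
  note U1 = orthonormal_colsD(1)[OF assms(1)]
  \<comment> \<open>Zero vectors in the place of \<open>w\<close> make this a pure completion of the
    columns of \<open>U1\<close>.\<close>
  obtain p where p: "\<forall>i<n. \<forall>j<n. (\<Sum>a<n. cnj (p i a) * p j a) = (if i = j then 1 else 0)"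
    and p1: "\<forall>i<r. p i = (\<lambda>a. U1 $$ (a,i))"
    using orthonormal_extend[OF assms(2) order_refl assms(1)[unfolded orthonormal_cols_iff[OF U1]],
        of "\<lambda>_ _. 0"]
    by (elim exE conjE)
  define U2 where "U2 = mat n (n - r) (\<lambda>(a,i). p (r + i) a)"
  have *: "hcat U1 U2 $$ (a,i) = p i a" if "a < n" "i < n" for a i
    using that p1 U1 assms(2) by (auto simp: hcat_def U2_def)
  have car: "hcat U1 U2 \<in> carrier_mat n n" using U1 assms(2) by (auto simp: hcat_def U2_def)
  show ?thesis
  proof
    show "U2 \<in> carrier_mat n (n - r)" by (simp add: U2_def)
    show "unitary_mat n (hcat U1 U2)"
      unfolding unitary_mat_iff_orthonormal_cols orthonormal_cols_iff[OF car] using p * by simp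
  qed
qed

lemma sum_lessThan_add:
  fixes f :: "nat \<Rightarrow> 'a::comm_monoid_add"
  shows "(\<Sum>i<r + s. f i) = (\<Sum>i<r. f i) + (\<Sum>i<s. f (r + i))"
  by (induction s) (auto simp: add.assoc)

text \<open>Reading \<open>adj V * V = 1\<close> blockwise for \<open>V = hcat U1 U2\<close> gives
  the first four identities, and \<open>V * adj V = 1\<close> gives the last. That one is a
  resolution of the identity: it rebuilds a matrix from its products with \<open>adj U1\<close> and
  \<open>adj U2\<close>.\<close>

lemma unitary_hcatD:
  assumes "U1 \<in> carrier_mat n r" "U2 \<in> carrier_mat n s" "n = r + s" "unitary_mat n (hcat U1 U2)"
  shows "adj U1 * U1 = 1\<^sub>m r" "adj U2 * U2 = 1\<^sub>m s" "adj U1 * U2 = 0\<^sub>m r s" "adj U2 * U1 = 0\<^sub>m s r"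
    "U1 * adj U1 + U2 * adj U2 = 1\<^sub>m n"
proof -
  let ?V = "hcat U1 U2"
  have V: "?V \<in> carrier_mat n n" using hcat_carrier[OF assms(1,2)] assms(3) by simp
  have V1: "?V $$ (a,i) = U1 $$ (a,i)" if "a < n" "i < r" for a i
    using that assms by (auto simp: hcat_def)
  have V2: "?V $$ (a, r + i) = U2 $$ (a,i)" if "a < n" "i < s" for a i
    using that assms by (auto simp: hcat_def)
  have *: "(\<Sum>a<n. cnj (?V $$ (a,i)) * ?V $$ (a,j)) = (if i = j then 1 else 0)" if "i < n" "j < n" for i j
    using assms(4) that unfolding unitary_mat_iff_orthonormal_cols orthonormal_cols_iff[OF V] by blast
  show "adj U1 * U1 = 1\<^sub>m r"
  proof (rule eq_matI)
    fix i j assume "i < dim_row (1\<^sub>m r)" "j < dim_col (1\<^sub>m r)"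
    then show "(adj U1 * U1) $$ (i,j) = 1\<^sub>m r $$ (i,j)"
      using *[of i j] V1 index_mult_sum[of "adj U1" r n U1 r i j] assms by simp
  qed (use assms in auto)
  show "adj U2 * U2 = 1\<^sub>m s"
  proof (rule eq_matI)
    fix i j assume "i < dim_row (1\<^sub>m s)" "j < dim_col (1\<^sub>m s)"
    then show "(adj U2 * U2) $$ (i,j) = 1\<^sub>m s $$ (i,j)"
      using *[of "r + i" "r + j"] V2 index_mult_sum[of "adj U2" s n U2 s i j] assms by simp
  qed (use assms in auto)
  show "adj U1 * U2 = 0\<^sub>m r s"
  proof (rule eq_matI)
    fix i j assume "i < dim_row (0\<^sub>m r s)" "j < dim_col (0\<^sub>m r s)"
    then show "(adj U1 * U2) $$ (i,j) = 0\<^sub>m r s $$ (i,j)"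
      using *[of i "r + j"] V1 V2 index_mult_sum[of "adj U1" r n U2 s i j] assms by simp
  qed (use assms in auto)
  show "adj U2 * U1 = 0\<^sub>m s r"
  proof (rule eq_matI)
    fix i j assume "i < dim_row (0\<^sub>m s r)" "j < dim_col (0\<^sub>m s r)"
    then show "(adj U2 * U1) $$ (i,j) = 0\<^sub>m s r $$ (i,j)"
      using *[of "r + i" j] V1 V2 index_mult_sum[of "adj U2" s n U1 r i j] assms by simp
  qed (use assms in auto)
  show "U1 * adj U1 + U2 * adj U2 = 1\<^sub>m n"
  proof (rule eq_matI)
    fix a b assume "a < dim_row (1\<^sub>m n)" "b < dim_col (1\<^sub>m n)"
    then have ab: "a < n" "b < n" by auto
    have "1\<^sub>m n $$ (a,b) = (?V * adj ?V) $$ (a,b)" using assms(4) by (simp add: unitary_mat_def)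
    also have "\<dots> = (\<Sum>l<n. ?V $$ (a,l) * adj ?V $$ (l,b))"
      by (rule index_mult_sum[OF V adj_carrier[OF V] ab])
    also have "\<dots> = (\<Sum>l<r + s. ?V $$ (a,l) * cnj (?V $$ (b,l)))"
      using ab V assms(3) by (intro sum.cong) auto
    also have "\<dots> = (\<Sum>l<r. U1 $$ (a,l) * cnj (U1 $$ (b,l))) + (\<Sum>l<s. U2 $$ (a,l) * cnj (U2 $$ (b,l)))"
      unfolding sum_lessThan_add using ab V1 V2 by simp
    also have "\<dots> = (U1 * adj U1) $$ (a,b) + (U2 * adj U2) $$ (a,b)"
      using index_mult_sum[of U1 n r "adj U1" n a b] index_mult_sum[of U2 n s "adj U2" n a b] ab assms by simp
    finally show "(U1 * adj U1 + U2 * adj U2) $$ (a,b) = 1\<^sub>m n $$ (a,b)"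
      using ab assms by simp
  qed (use assms in auto)
qed

section \<open>Real coordinates\<close>

text \<open>The product is taken on lists rather than vectors because \<open>tau\<close> and
  \<open>mu\<close> are built by \<open>map\<close>, \<open>concat\<close> and append, and it splits
  along these.\<close>

definition dot_list :: "real list \<Rightarrow> real list \<Rightarrow> real" where
  "dot_list xs ys = (\<Sum>(x,y)\<leftarrow>zip xs ys. x * y)"

lemma dot_list_append:
  "length xs = length xs' \<Longrightarrow> dot_list (xs @ ys) (xs' @ ys') = dot_list xs xs' + dot_list ys ys'"
  by (simp add: dot_list_def)

lemma dot_list_map: "dot_list (map f L) (map g L) = (\<Sum>x\<leftarrow>L. f x * g x)"
  by (induction L) (auto simp: dot_list_def)

lemma dot_list_concat:
  "(\<And>x. x \<in> set L \<Longrightarrow> length (f x) = length (g x)) \<Longrightarrow>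
    dot_list (concat (map f L)) (concat (map g L)) = (\<Sum>x\<leftarrow>L. dot_list (f x) (g x))"
proof (induction L)
  case Nil
  then show ?case by (simp add: dot_list_def)
next
  case (Cons a L)
  then show ?case by (simp add: dot_list_append)
qed

lemma dot_list_nth: "length xs = length ys \<Longrightarrow> dot_list xs ys = (\<Sum>i<length xs. xs ! i * ys ! i)"
  by (simp add: dot_list_def sum_list_sum_nth atLeast0LessThan)

lemma sum_list_upt: "(\<Sum>i\<leftarrow>[0..<q]. f i) = (\<Sum>i<q. f i :: 'a::comm_monoid_add)"
  by (simp add: interv_sum_list_conv_sum_set_nat atLeast0LessThan)

text \<open>This inverts the layouts of \<open>mu\<close> and \<open>tau\<close>: with constant
  \<open>N\<close> the blocks are whole columns, with \<open>N j = j\<close> they are the columns of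
  a strict upper triangle.\<close>

lemma split_list_blocks:
  "length xs = (\<Sum>j<q. N j) \<Longrightarrow> \<exists>g. xs = concat (map (\<lambda>j. map (g j) [0..<N j]) [0..<q])"
proof (induction q arbitrary: xs)
  case 0
  then show ?case by simp
next
  case (Suc q)
  let ?s = "\<Sum>j<q. N j"
  obtain g where g: "take ?s xs = concat (map (\<lambda>j. map (g j) [0..<N j]) [0..<q])"
    using Suc.IH[of "take ?s xs"] Suc.prems by auto
  have d: "drop ?s xs = map (\<lambda>i. xs ! (?s + i)) [0..<N q]"
    using Suc.prems by (intro nth_equalityI) auto
  have "xs = take ?s xs @ drop ?s xs" by simp
  also have "\<dots> = concat (map (\<lambda>j. map ((g(q := \<lambda>i. xs ! (?s + i))) j) [0..<N j]) [0..<Suc q])"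
    unfolding g d by (auto intro!: arg_cong[of _ _ concat])
  finally show ?case by blast
qed

lemma nth_concat_blocks:
  assumes "\<And>k. k < q \<Longrightarrow> length (f k) = N" "a < q * N"
  shows "concat (map f [0..<q]) ! a = f (a div N) ! (a mod N)"
  using assms
proof (induction q)
  case (Suc q)
  have len: "length (concat (map f [0..<q])) = q * N"
    using Suc.prems by (simp add: length_concat sum_list_upt comp_def)
  show ?case
  proof (cases "a < q * N")
    case True
    then show ?thesis using Suc len by (simp add: nth_append)
  next
    case False
    have "a div N = q"
      using False Suc.prems by (intro div_nat_eqI) (auto simp: mult.commute)
    moreover from this have "a mod N = a - q * N"
      by (metis minus_div_mult_eq_mod)
    ultimately show ?thesis using False len by (simp add: nth_append)
  qed
qed simp

lemma length_mu: "X \<in> carrier_mat p q \<Longrightarrow> length (mu X) = 2 * p * q"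
  by (simp add: mu_def length_concat sum_list_upt comp_def)

lemma mu_nth:
  assumes "X \<in> carrier_mat p q" "a < 2 * p * q"
  shows "mu X ! a = (if a mod (2 * p) < p then Re (X $$ (a mod (2 * p), a div (2 * p)))
    else Im (X $$ (a mod (2 * p) - p, a div (2 * p))))"
proof -
  have "a mod (2 * p) < 2 * p" using assms(2) by (intro mod_less_divisor) (cases p; simp)
  moreover have "a < q * (2 * p)" using assms(2) by (simp add: mult.commute)
  ultimately show ?thesis
    unfolding mu_def using assms(1) by (subst nth_concat_blocks[where N = "2 * p"]) (auto simp: nth_append)
qed

lemma dot_list_mu:
  assumes "X \<in> carrier_mat p q" "Y \<in> carrier_mat p q"
  shows "dot_list (mu X) (mu Y) = rinner X Y"
  unfolding mu_def rinner_sum[OF assms] using assms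
  by (simp add: dot_list_concat dot_list_append dot_list_map sum_list_upt sum.distrib)

lemma mu_surj:
  assumes "length xs = 2 * p * q"
  obtains X where "X \<in> carrier_mat p q" "mu X = xs"
proof -
  obtain g where g: "xs = concat (map (\<lambda>j. map (g j) [0..<2 * p]) [0..<q])"
    using split_list_blocks[of xs "\<lambda>_. 2 * p" q] assms by (auto simp: mult.commute)
  \<comment> \<open>Each stacked block of length \<open>2 * p\<close> holds the real parts and then
    the imaginary parts of one column.\<close>
  have "map (g j) [0..<2 * p] = map (g j) [0..<p] @ map (\<lambda>i. g j (p + i)) [0..<p]" for j
    by (rule nth_equalityI) (auto simp: nth_append)
  then have "mu (mat p q (\<lambda>(i,k). Complex (g k i) (g k (p + i)))) = xs"
    unfolding g mu_def by (auto intro!: arg_cong[of _ _ concat])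
  then show ?thesis using that by (metis mat_carrier)
qed

section \<open>The coordinates \<open>tau\<close> of Hermitian matrices\<close>

lemma upper_list_eq:
  "X \<in> carrier_mat r r \<Longrightarrow> map f (upper_list X) = concat (map (\<lambda>j. map (\<lambda>i. f (X $$ (i,j))) [0..<j]) [0..<r])"
  by (simp add: upper_list_def map_concat comp_def)

lemma length_upper_list: "X \<in> carrier_mat r r \<Longrightarrow> length (upper_list X) = (\<Sum>j<r. j)"
  by (simp add: upper_list_def length_concat comp_def atLeast0LessThan)

text \<open>The real dimension of the Hermitian matrices: \<open>r\<close> diagonal entries, and two
  real numbers for each entry above the diagonal.\<close>

lemma double_sum_lessThan: "r + 2 * (\<Sum>j<r. j) = r\<^sup>2" for r :: nat
  by (induction r) (auto simp: power2_eq_square)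

lemma length_tau: "X \<in> carrier_mat r r \<Longrightarrow> length (tau X) = r\<^sup>2"
  using double_sum_lessThan[of r] by (simp add: tau_def length_upper_list)

lemma sum_symmetric_split:
  fixes f :: "nat \<Rightarrow> nat \<Rightarrow> real"
  assumes "\<And>i j. i < r \<Longrightarrow> j < r \<Longrightarrow> f i j = f j i"
  shows "(\<Sum>j<r. \<Sum>i<r. f i j) = (\<Sum>i<r. f i i) + 2 * (\<Sum>j<r. \<Sum>i<j. f i j)"
  using assms
proof (induction r)
  case (Suc r)
  have "(\<Sum>j<r. f r j) = (\<Sum>j<r. f j r)" using Suc.prems by (intro sum.cong) auto
  then show ?case using Suc by (simp add: sum.distrib)
qed simp

text \<open>In \<open>rinner\<close> every pair of conjugate off-diagonal entries contributes twice,
  which the factor \<open>sqrt 2\<close> in \<open>tau\<close> reproduces; the diagonal is real, so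
  its imaginary parts add nothing.\<close>

lemma dot_list_tau:
  assumes "hermitian_mat r X" "hermitian_mat r Y"
  shows "dot_list (tau X) (tau Y) = rinner X Y"
proof -
  have c: "X \<in> carrier_mat r r" "Y \<in> carrier_mat r r" and a: "adj X = X" "adj Y = Y"
    using assms by (auto simp: hermitian_mat_def)
  have X: "X $$ (j,i) = cnj (X $$ (i,j))" if "i < r" "j < r" for i j
    using that c arg_cong[OF a(1), of "\<lambda>M. M $$ (j,i)"] by simp
  have Y: "Y $$ (j,i) = cnj (Y $$ (i,j))" if "i < r" "j < r" for i j
    using that c arg_cong[OF a(2), of "\<lambda>M. M $$ (j,i)"] by simp
  define f where "f i j = Re (X $$ (i,j)) * Re (Y $$ (i,j)) + Im (X $$ (i,j)) * Im (Y $$ (i,j))" for i j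
  have "Im (X $$ (i,i)) = 0" if "i < r" for i
    using arg_cong[OF X[OF that that], of Im] by simp
  then have diag: "f i i = Re (X $$ (i,i)) * Re (Y $$ (i,i))" if "i < r" for i
    using that by (simp add: f_def)
  have sym: "f i j = f j i" if "i < r" "j < r" for i j
    using X[OF that] Y[OF that] by (simp add: f_def)
  have sqrt2: "sqrt 2 * x * (sqrt 2 * y) = 2 * (x * y)" for x y
  proof -
    have "sqrt 2 * x * (sqrt 2 * y) = (sqrt 2 * sqrt 2) * (x * y)" by (simp only: ac_simps)
    then show ?thesis by simp
  qed
  have "dot_list (tau X) (tau Y) = (\<Sum>i<r. f i i) +
      (\<Sum>j<r. \<Sum>i<j. 2 * (Re (X $$ (i,j)) * Re (Y $$ (i,j)))) +
      (\<Sum>j<r. \<Sum>i<j. 2 * (Im (X $$ (i,j)) * Im (Y $$ (i,j))))"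
    unfolding tau_def using c
    by (simp add: dot_list_append length_upper_list)
      (simp add: upper_list_eq dot_list_concat dot_list_map sum_list_upt diag sqrt2)
  also have "\<dots> = (\<Sum>i<r. f i i) + 2 * (\<Sum>j<r. \<Sum>i<j. f i j)"
    by (simp add: f_def sum.distrib sum_distrib_left)
  also have "\<dots> = rinner X Y"
    using sum_symmetric_split[of r f, OF sym] unfolding rinner_sum[OF c] by (simp add: f_def)
  finally show ?thesis .
qed

lemma tau_surj:
  assumes "length xs = r\<^sup>2"
  obtains H where "hermitian_mat r H" "tau H = xs"
proof -
  let ?T = "\<Sum>j<r. j"
  have len: "length xs = r + (?T + ?T)" using assms double_sum_lessThan[of r] by simp
  obtain g where g: "take ?T (drop r xs) = concat (map (\<lambda>j. map (g j) [0..<j]) [0..<r])"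
    using split_list_blocks[of "take ?T (drop r xs)" "\<lambda>j. j" r] len by auto
  obtain h where h: "drop ?T (drop r xs) = concat (map (\<lambda>j. map (h j) [0..<j]) [0..<r])"
    using split_list_blocks[of "drop ?T (drop r xs)" "\<lambda>j. j" r] len by auto
  \<comment> \<open>The list splits into diagonal, real and imaginary parts. The functions
    \<open>g\<close> and \<open>h\<close> take the column first, the division by
    \<open>sqrt 2\<close> undoes the scaling in \<open>tau\<close>, and the lower triangle is filled
    by conjugation.\<close>
  define H where "H = mat r r (\<lambda>(i,j). if i = j then complex_of_real (xs ! i)
    else if i < j then Complex (g j i / sqrt 2) (h j i / sqrt 2)
    else Complex (g i j / sqrt 2) (- (h i j / sqrt 2)))"
  have Hc: "H \<in> carrier_mat r r" by (simp add: H_def)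
  show ?thesis
  proof
    show "hermitian_mat r H"
      unfolding hermitian_mat_def using Hc
      by (auto simp: H_def complex_eq_iff)
    have "map (\<lambda>i. Re (H $$ (i,i))) [0..<r] = take r xs"
      using len by (intro nth_equalityI) (auto simp: H_def)
    moreover have "map (\<lambda>x. sqrt 2 * Re x) (upper_list H) = take ?T (drop r xs)"
      unfolding upper_list_eq[OF Hc] g by (auto simp: H_def intro!: arg_cong[of _ _ concat])
    moreover have "map (\<lambda>x. sqrt 2 * Im x) (upper_list H) = drop ?T (drop r xs)"
      unfolding upper_list_eq[OF Hc] h by (auto simp: H_def intro!: arg_cong[of _ _ concat])
    ultimately have "tau H = take r xs @ take ?T (drop r xs) @ drop ?T (drop r xs)"
      using Hc unfolding tau_def by (simp del: drop_drop)
    then show "tau H = xs" by (simp del: drop_drop)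
  qed
qed

section \<open>Gram matrices\<close>

text \<open>The sum of the rank-one matrices \<open>v\<^sub>j v\<^sub>j\<^sup>T\<close>.
  \<open>Qmat\<close> has this form, and so does \<open>Qhat\<close> up to the factor 4, so one
  kernel computation serves both.\<close>

definition gram_mat :: "nat \<Rightarrow> nat \<Rightarrow> (nat \<Rightarrow> real list) \<Rightarrow> real mat" where
  "gram_mat d m v = mat d d (\<lambda>(a,b). \<Sum>j<m. v j ! a * v j ! b)"

lemma gram_mat_carrier [simp]: "gram_mat d m v \<in> carrier_mat d d"
  by (simp add: gram_mat_def)

lemma gram_mat_mult_vec:
  assumes "\<And>j. j < m \<Longrightarrow> length (v j) = d" "length xs = d" "a < d"
  shows "(gram_mat d m v *\<^sub>v vec_of_list xs) $ a = (\<Sum>j<m. v j ! a * dot_list (v j) xs)"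
proof -
  have "(gram_mat d m v *\<^sub>v vec_of_list xs) $ a = (\<Sum>b<d. \<Sum>j<m. v j ! a * (v j ! b * xs ! b))"
    using assms
    by (simp add: gram_mat_def scalar_prod_def atLeast0LessThan sum_distrib_right vec_of_list_index mult.assoc)
  also have "\<dots> = (\<Sum>j<m. \<Sum>b<d. v j ! a * (v j ! b * xs ! b))" by (rule sum.swap)
  also have "\<dots> = (\<Sum>j<m. v j ! a * dot_list (v j) xs)"
    using assms by (intro sum.cong refl) (simp add: dot_list_nth sum_distrib_left)
  finally show ?thesis .
qed

text \<open>\<open>x\<^sup>T G x = \<Sum>j. (v\<^sub>j\<^sup>T x)\<^sup>2\<close> for the Gram matrix \<open>G\<close>.\<close>
lemma gram_mat_kernel:
  assumes v: "\<And>j. j < m \<Longrightarrow> length (v j) = d" and x: "length xs = d"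
  shows "gram_mat d m v *\<^sub>v vec_of_list xs = 0\<^sub>v d \<longleftrightarrow> (\<forall>j<m. dot_list (v j) xs = 0)"
proof
  assume *: "gram_mat d m v *\<^sub>v vec_of_list xs = 0\<^sub>v d"
  have "(\<Sum>j<m. (dot_list (v j) xs)\<^sup>2) = (\<Sum>j<m. \<Sum>a<d. xs ! a * (v j ! a * dot_list (v j) xs))"
    using v x by (intro sum.cong refl)
      (simp add: power2_eq_square dot_list_nth sum_distrib_right mult.assoc mult.left_commute)
  also have "\<dots> = (\<Sum>a<d. xs ! a * (\<Sum>j<m. v j ! a * dot_list (v j) xs))"
    by (subst sum.swap) (simp add: sum_distrib_left)
  also have "\<dots> = 0"
    using * gram_mat_mult_vec[of m v d xs] v x by (intro sum.neutral) auto
  finally show "\<forall>j<m. dot_list (v j) xs = 0"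
    by (subst (asm) sum_nonneg_eq_0_iff) auto
next
  assume *: "\<forall>j<m. dot_list (v j) xs = 0"
  show "gram_mat d m v *\<^sub>v vec_of_list xs = 0\<^sub>v d"
  proof (rule eq_vecI)
    fix a assume "a < dim_vec (0\<^sub>v d)"
    then show "(gram_mat d m v *\<^sub>v vec_of_list xs) $ a = 0\<^sub>v d $ a"
      using * gram_mat_mult_vec[of m v d xs a] v x by simp
  qed (simp add: gram_mat_def)
qed

text \<open>In the direction that constructs an inverse, a trivial kernel gives a nonzero
  determinant and thus a unit of the matrix ring.\<close>

lemma invertible_mat_iff_kernel:
  fixes M :: "real mat"
  assumes M: "M \<in> carrier_mat d d"
  shows "invertible_mat M \<longleftrightarrow> (\<forall>x \<in> carrier_vec d. M *\<^sub>v x = 0\<^sub>v d \<longrightarrow> x = 0\<^sub>v d)"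
proof
  assume "invertible_mat M"
  then obtain B where B: "M * B = 1\<^sub>m (dim_row M)" "B * M = 1\<^sub>m (dim_row B)"
    unfolding invertible_mat_def inverts_mat_def by auto
  \<comment> \<open>\<open>invertible_mat\<close> does not fix the shape of the inverse; it is read
    off from the dimensions of the two products.\<close>
  have "dim_row B = d" "dim_col B = d"
    using arg_cong[OF B(1), of dim_col] arg_cong[OF B(2), of dim_col] M by auto
  then have Bc: "B \<in> carrier_mat d d" by auto
  show "\<forall>x \<in> carrier_vec d. M *\<^sub>v x = 0\<^sub>v d \<longrightarrow> x = 0\<^sub>v d"
  proof (intro ballI impI)
    fix x assume x: "x \<in> carrier_vec d" "M *\<^sub>v x = 0\<^sub>v d"
    have "x = (B * M) *\<^sub>v x" using x B(2) Bc by simp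
    also have "\<dots> = B *\<^sub>v (M *\<^sub>v x)" using Bc M x by simp
    finally show "x = 0\<^sub>v d" using x(2) Bc by (auto simp: scalar_prod_def)
  qed
next
  assume "\<forall>x \<in> carrier_vec d. M *\<^sub>v x = 0\<^sub>v d \<longrightarrow> x = 0\<^sub>v d"
  then have "det M \<noteq> 0" using det_0_iff_vec_prod_zero_field[OF M] by blast
  from det_non_zero_imp_unit[OF M this, of "()"] obtain B where "B \<in> carrier_mat d d"
    "B * M = 1\<^sub>m d" "M * B = 1\<^sub>m d"
    by (auto simp: Units_def ring_mat_def)
  then show "invertible_mat M"
    using M unfolding invertible_mat_def inverts_mat_def by auto
qed

section \<open>The real matrix of left multiplication\<close>

lemma kron_id_jmat_carrier:
  "A \<in> carrier_mat n n \<Longrightarrow> kron_id r (jmat A) \<in> carrier_mat (2 * n * r) (2 * n * r)"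
  by (simp add: kron_id_def jmat_def mult.commute mult.left_commute)

text \<open>A Hermitian \<open>A\<close> has symmetric real part and antisymmetric imaginary part,
  so \<open>jmat A\<close> is symmetric, and \<open>kron_id\<close> repeats it along the
  diagonal.\<close>

lemma kron_id_jmat_symmetric:
  assumes "hermitian_mat n A" "a < 2 * n * r" "b < 2 * n * r"
  shows "kron_id r (jmat A) $$ (a,b) = kron_id r (jmat A) $$ (b,a)"
proof -
  have A: "A \<in> carrier_mat n n" "adj A = A" using assms(1) by (auto simp: hermitian_mat_def)
  have s: "A $$ (j,i) = cnj (A $$ (i,j))" if "i < n" "j < n" for i j
    using that A(1) arg_cong[OF A(2), of "\<lambda>M. M $$ (j,i)"] by simp
  have j: "jmat A $$ (i,k) = jmat A $$ (k,i)" if "i < 2 * n" "k < 2 * n" for i k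
    using that A(1) s[of i k] s[of "i - n" k] s[of i "k - n"] s[of "i - n" "k - n"]
    by (auto simp: jmat_def)
  have "n > 0" using assms(2) by (cases n) auto
  then show ?thesis
    using assms(2,3) A(1) j[of "a mod (2 * n)" "b mod (2 * n)"]
    by (auto simp: kron_id_def mult.commute mult.left_commute jmat_def dest: sym)
qed

text \<open>In the coordinates \<open>mu\<close>, left multiplication by \<open>A\<close> acts on
  each column separately, and on the stacked real and imaginary parts of one column it is
  \<open>jmat A\<close>.\<close>

lemma sum_kron_id_jmat_mu:
  assumes A: "A \<in> carrier_mat n n" and z: "z \<in> carrier_mat n r" and a: "a < 2 * n * r"
  shows "(\<Sum>b<2 * n * r. kron_id r (jmat A) $$ (a,b) * mu z ! b) = mu (A * z) ! a"
proof -
  \<comment> \<open>Index \<open>a\<close> is position \<open>i\<close> in column \<open>k\<close>;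
    of the column blocks summed below only block \<open>k\<close> contributes.\<close>
  define N i k where "N = 2 * n" and "i = a mod N" and "k = a div N"
  have "n > 0" using a by (cases n) auto
  then have N: "N > 0" and i: "i < N" by (auto simp: N_def i_def)
  have k: "k < r" using a unfolding k_def N_def by (simp add: less_mult_imp_div_less mult.commute)
  have "(\<Sum>b<2 * n * r. kron_id r (jmat A) $$ (a,b) * mu z ! b)
      = (\<Sum>k'<r. \<Sum>b\<in>{k' * N..<k' * N + N}. kron_id r (jmat A) $$ (a,b) * mu z ! b)"
    by (simp add: N_def sum.nat_group mult.commute)
  also have "\<dots> = (\<Sum>k'<r. \<Sum>i'<N. kron_id r (jmat A) $$ (a, k' * N + i') * mu z ! (k' * N + i'))"
    by (subst sum.atLeastLessThan_shift_0) (simp add: atLeast0LessThan comp_def)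
  also have "\<dots> = (\<Sum>k'<r. \<Sum>i'<N. if k' = k then jmat A $$ (i,i') *
      (if i' < n then Re (z $$ (i',k)) else Im (z $$ (i' - n,k))) else 0)"
  proof (intro sum.cong refl)
    fix k' i' assume *: "k' \<in> {..<r}" "i' \<in> {..<N}"
    then have lt: "k' * N + i' < 2 * n * r"
      using mult_le_mono1[of "Suc k'" r N] by (simp add: N_def mult.commute)
    have *: "(k' * N + i') mod N = i'" "(k' * N + i') div N = k'" using * by auto
    have "mu z ! (k' * N + i') = (if i' < n then Re (z $$ (i',k')) else Im (z $$ (i' - n,k')))"
      using mu_nth[OF z lt] * unfolding N_def by simp
    moreover have "kron_id r (jmat A) $$ (a, k' * N + i') = (if k' = k then jmat A $$ (i,i') else 0)"
      using lt a A * unfolding kron_id_def i_def k_def N_def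
      by (auto simp: jmat_def mult.commute mult.left_commute)
    ultimately show "kron_id r (jmat A) $$ (a, k' * N + i') * mu z ! (k' * N + i')
      = (if k' = k then jmat A $$ (i,i') *
      (if i' < n then Re (z $$ (i',k)) else Im (z $$ (i' - n,k))) else 0)"
      by simp
  qed
  also have "\<dots> = (\<Sum>k'<r. if k' = k then \<Sum>i'<N. jmat A $$ (i,i') *
      (if i' < n then Re (z $$ (i',k)) else Im (z $$ (i' - n,k))) else 0)"
    by (intro sum.cong) auto
  also have "\<dots> = (\<Sum>i'<n + n. jmat A $$ (i,i') *
      (if i' < n then Re (z $$ (i',k)) else Im (z $$ (i' - n,k))))"
    using k by (simp add: N_def mult_2)
  also have "\<dots> = (\<Sum>i'<n. jmat A $$ (i,i') * Re (z $$ (i',k))) + (\<Sum>i'<n. jmat A $$ (i,n + i') * Im (z $$ (i',k)))"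
    unfolding sum_lessThan_add by simp
  also have "\<dots> = mu (A * z) ! a"
  proof (cases "i < n")
    case True
    have "mu (A * z) ! a = Re ((A * z) $$ (i,k))"
      using mu_nth[of "A * z" n r a] A z a True unfolding i_def k_def N_def by simp
    also have "\<dots> = (\<Sum>l<n. Re (A $$ (i,l)) * Re (z $$ (l,k)) - Im (A $$ (i,l)) * Im (z $$ (l,k)))"
      using index_mult_sum[OF A z True k] by simp
    finally show ?thesis using True A by (simp add: jmat_def sum_subtractf sum_negf)
  next
    case False
    then have in': "i - n < n" using i by (auto simp: N_def)
    have "mu (A * z) ! a = Im ((A * z) $$ (i - n,k))"
      using mu_nth[of "A * z" n r a] A z a False unfolding i_def k_def N_def by simp
    also have "\<dots> = (\<Sum>l<n. Re (A $$ (i - n,l)) * Im (z $$ (l,k)) + Im (A $$ (i - n,l)) * Re (z $$ (l,k)))"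
      using index_mult_sum[OF A z in' k] by simp
    finally show ?thesis using False i A by (simp add: jmat_def N_def sum.distrib)
  qed
  finally show ?thesis .
qed

text \<open>For symmetric \<open>K\<close> and \<open>x = mu z\<close>, the product
  \<open>K x x\<^sup>T K\<close> is the rank-one matrix of \<open>K x\<close>, and here
  \<open>K x\<close> is \<open>mu (A j * z)\<close>.\<close>

lemma Qhat_eq_gram_mat:
  assumes herm: "\<forall>j<m. hermitian_mat n (A j)" and z: "z \<in> carrier_mat n r"
  shows "Qhat m A z = 4 \<cdot>\<^sub>m gram_mat (2 * n * r) m (\<lambda>j. mu (A j * z))"
proof (rule eq_matI)
  fix a b assume "a < dim_row (4 \<cdot>\<^sub>m gram_mat (2 * n * r) m (\<lambda>j. mu (A j * z)))"
    "b < dim_col (4 \<cdot>\<^sub>m gram_mat (2 * n * r) m (\<lambda>j. mu (A j * z)))"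
  then have ab: "a < 2 * n * r" "b < 2 * n * r" by (auto simp: gram_mat_def)
  have "(kron_id r (jmat (A j)) * outer (mu z) * kron_id r (jmat (A j))) $$ (a,b)
      = mu (A j * z) ! a * mu (A j * z) ! b" if "j < m" for j
  proof -
    let ?D = "2 * n * r" and ?K = "kron_id r (jmat (A j))"
    have A: "A j \<in> carrier_mat n n" using herm that by (simp add: hermitian_mat_def)
    note K = kron_id_jmat_carrier[OF A, of r]
    have O: "outer (mu z) \<in> carrier_mat ?D ?D" by (simp add: outer_def length_mu[OF z])
    have "(?K * outer (mu z) * ?K) $$ (a,b) = (\<Sum>c<?D. (?K * outer (mu z)) $$ (a,c) * ?K $$ (c,b))"
      by (rule index_mult_sum[OF mult_carrier_mat[OF K O] K ab])
    also have "\<dots> = (\<Sum>c<?D. (mu (A j * z) ! a * mu z ! c) * ?K $$ (b,c))"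
    proof (intro sum.cong refl)
      fix c assume "c \<in> {..<?D}"
      then have c: "c < ?D" by simp
      have "(?K * outer (mu z)) $$ (a,c) = (\<Sum>l<?D. ?K $$ (a,l) * outer (mu z) $$ (l,c))"
        by (rule index_mult_sum[OF K O ab(1) c])
      also have "\<dots> = (\<Sum>l<?D. ?K $$ (a,l) * mu z ! l) * mu z ! c"
        using c by (simp add: outer_def length_mu[OF z] sum_distrib_right mult.assoc)
      finally show "(?K * outer (mu z)) $$ (a,c) * ?K $$ (c,b) = (mu (A j * z) ! a * mu z ! c) * ?K $$ (b,c)"
        using sum_kron_id_jmat_mu[OF A z ab(1)] kron_id_jmat_symmetric[of n "A j" b r c] herm that ab c
        by simp
    qed
    also have "\<dots> = mu (A j * z) ! a * (\<Sum>c<?D. ?K $$ (b,c) * mu z ! c)"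
      by (simp add: sum_distrib_left mult.assoc mult.commute[of "mu z ! _"])
    finally show ?thesis using sum_kron_id_jmat_mu[OF A z ab(2)] by simp
  qed
  then show "Qhat m A z $$ (a,b) = (4 \<cdot>\<^sub>m gram_mat (2 * n * r) m (\<lambda>j. mu (A j * z))) $$ (a,b)"
    using ab z by (simp add: Qhat_def gram_mat_def Let_def del: index_mult_mat(1))
qed (use z in \<open>auto simp: Qhat_def gram_mat_def Let_def\<close>)

lemma rinner_self_nonneg: "X \<in> carrier_mat p q \<Longrightarrow> 0 \<le> rinner X X"
  by (simp add: rinner_sum sum_nonneg)

lemma hermitian_matD:
  assumes "hermitian_mat n A"
  shows "A \<in> carrier_mat n n" "adj A = A"
  using assms by (auto simp: hermitian_mat_def)

lemma skew_hermitian_matD: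
  assumes "skew_hermitian_mat n A"
  shows "A \<in> carrier_mat n n" "adj A = - A"
  using assms by (auto simp: skew_hermitian_mat_def)

lemma rinner_hermitian_shift:
  assumes "hermitian_mat n A" "X \<in> carrier_mat n s" "Y \<in> carrier_mat n s"
  shows "rinner (A * X) Y = rinner X (A * Y)"
  using rinner_mult_left[OF hermitian_matD(1)[OF assms(1)] assms(2,3)] hermitian_matD(2)[OF assms(1)] by simp

lemma Re_ctrace_quadratic:
  assumes "A \<in> carrier_mat n n" "z \<in> carrier_mat n r"
  shows "Re (ctrace (A * z * adj z)) = rinner z (A * z)"
  unfolding rinner_def using assms by (subst ctrace_mult_comm[of _ n r]) auto

section \<open>Phase retrievability\<close>

text \<open>The two sides of the first equation differ by \<open>4 * rinner u (A * v)\<close>, since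
  a Hermitian \<open>A\<close> makes the two mixed terms equal.\<close>

lemma hermitian_form_polarization:
  assumes A: "hermitian_mat n A" and u: "u \<in> carrier_mat n r" and v: "v \<in> carrier_mat n r"
  shows "rinner (u + v) (A * (u + v)) = rinner (u - v) (A * (u - v)) \<longleftrightarrow> rinner u (A * v) = 0"
proof -
  note Ac = hermitian_matD(1)[OF A]
  have c: "A * u \<in> carrier_mat n r" "A * v \<in> carrier_mat n r"
    using Ac u v by auto
  have "rinner v (A * u) = rinner u (A * v)"
    using rinner_hermitian_shift[OF A u v] rinner_commute[OF v c(1)] by simp
  then show ?thesis
    using u v c add_carrier_mat[OF v, of u] minus_carrier_mat[OF v, of u]
    by (simp add: mult_add_distrib_mat[OF Ac u v] mult_minus_distrib_mat[OF Ac u v]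
      rinner_add_right[of _ n r] rinner_minus_right[of _ n r] rinner_add_left[of _ n r] rinner_minus_left[of _ n r])
qed

text \<open>In the difference of the two products the square terms cancel and twice the mixed terms
  remain.\<close>

lemma outer_polarization:
  assumes u: "u \<in> carrier_mat n r" and v: "v \<in> carrier_mat n r"
  shows "(u + v) * adj (u + v) = (u - v) * adj (u - v) \<longleftrightarrow> u * adj v + v * adj u = 0\<^sub>m n n"
proof -
  have *: "((u + v) * adj (u + v)) $$ (i,j) - ((u - v) * adj (u - v)) $$ (i,j) = 2 * (u * adj v + v * adj u) $$ (i,j)"
    if ij: "i < n" "j < n" for i j
  proof -
    have "((u + v) * adj (u + v)) $$ (i,j) = (\<Sum>l<r. (u $$ (i,l) + v $$ (i,l)) * cnj (u $$ (j,l) + v $$ (j,l)))"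
      using index_mult_sum[of "u + v" n r "adj (u + v)" n i j] u v ij by simp
    moreover have "((u - v) * adj (u - v)) $$ (i,j) = (\<Sum>l<r. (u $$ (i,l) - v $$ (i,l)) * cnj (u $$ (j,l) - v $$ (j,l)))"
      using index_mult_sum[of "u - v" n r "adj (u - v)" n i j] u v ij by (simp add: minus_carrier_mat)
    moreover have "(u * adj v + v * adj u) $$ (i,j) = (\<Sum>l<r. u $$ (i,l) * cnj (v $$ (j,l))) + (\<Sum>l<r. v $$ (i,l) * cnj (u $$ (j,l)))"
      using index_mult_sum[of u n r "adj v" n i j] index_mult_sum[of v n r "adj u" n i j] u v ij by simp
    ultimately show ?thesis
      by (simp add: sum_subtractf[symmetric] sum.distrib[symmetric] sum_distrib_left algebra_simps)
  qed
  have d: "dim_row ((u + v) * adj (u + v)) = n" "dim_col ((u + v) * adj (u + v)) = n"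
    "dim_row ((u - v) * adj (u - v)) = n" "dim_col ((u - v) * adj (u - v)) = n"
    "dim_row (u * adj v + v * adj u) = n" "dim_col (u * adj v + v * adj u) = n"
    using u v by auto
  show ?thesis
  proof
    assume e: "(u + v) * adj (u + v) = (u - v) * adj (u - v)"
    show "u * adj v + v * adj u = 0\<^sub>m n n"
    proof (rule eq_matI)
      fix i j assume "i < dim_row (0\<^sub>m n n)" "j < dim_col (0\<^sub>m n n)"
      then show "(u * adj v + v * adj u) $$ (i,j) = 0\<^sub>m n n $$ (i,j)"
        using *[of i j] unfolding e by simp
    qed (use d in auto)
  next
    assume e: "u * adj v + v * adj u = 0\<^sub>m n n"
    show "(u + v) * adj (u + v) = (u - v) * adj (u - v)"
    proof (rule eq_matI)
      fix i j assume "i < dim_row ((u - v) * adj (u - v))" "j < dim_col ((u - v) * adj (u - v))"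
      then show "((u + v) * adj (u + v)) $$ (i,j) = ((u - v) * adj (u - v)) $$ (i,j)"
        using *[of i j] d unfolding e by simp
    qed (use d in auto)
  qed
qed

text \<open>Half sum and half difference turn any pair \<open>x\<close>, \<open>y\<close> into a
  pair \<open>u\<close>, \<open>v\<close>, which trades a condition on quadratic maps for a bilinear
  one.\<close>

lemma gen_phase_retrievable_iff:
  assumes herm: "\<forall>j<m. hermitian_mat n (A j)"
  shows "gen_phase_retrievable n r m A \<longleftrightarrow>
    (\<forall>u \<in> carrier_mat n r. \<forall>v \<in> carrier_mat n r.
      (\<forall>j<m. rinner u (A j * v) = 0) \<longrightarrow> u * adj v + v * adj u = 0\<^sub>m n n)"
proof -
  have beta: "beta_map m A (u + v) = beta_map m A (u - v) \<longleftrightarrow> (\<forall>j<m. rinner u (A j * v) = 0)"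
    if uv: "u \<in> carrier_mat n r" "v \<in> carrier_mat n r" for u v
  proof -
    have c: "u + v \<in> carrier_mat n r" "u - v \<in> carrier_mat n r"
      using uv by (auto simp: minus_carrier_mat)
    have "beta_map m A (u + v) = beta_map m A (u - v) \<longleftrightarrow>
      (\<forall>j<m. Re (ctrace (A j * (u + v) * adj (u + v))) = Re (ctrace (A j * (u - v) * adj (u - v))))"
      unfolding beta_map_def fun_eq_iff by auto
    also have "\<dots> \<longleftrightarrow> (\<forall>j<m. rinner (u + v) (A j * (u + v)) = rinner (u - v) (A j * (u - v)))"
      using c herm hermitian_matD(1) by (auto simp: Re_ctrace_quadratic[of _ n _ r])
    also have "\<dots> \<longleftrightarrow> (\<forall>j<m. rinner u (A j * v) = 0)"
      using hermitian_form_polarization[OF _ uv] herm by blast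
    finally show ?thesis .
  qed
  show ?thesis
  proof
    assume g: "gen_phase_retrievable n r m A"
    show "\<forall>u \<in> carrier_mat n r. \<forall>v \<in> carrier_mat n r.
      (\<forall>j<m. rinner u (A j * v) = 0) \<longrightarrow> u * adj v + v * adj u = 0\<^sub>m n n"
    proof (intro ballI impI)
      fix u v assume uv: "u \<in> carrier_mat n r" "v \<in> carrier_mat n r" and "\<forall>j<m. rinner u (A j * v) = 0"
      then have "(u + v) * adj (u + v) = (u - v) * adj (u - v)"
        using g beta[OF uv] unfolding gen_phase_retrievable_def by (simp add: minus_carrier_mat)
      then show "u * adj v + v * adj u = 0\<^sub>m n n" using outer_polarization[OF uv] by simp
    qed
  next
    assume g: "\<forall>u \<in> carrier_mat n r. \<forall>v \<in> carrier_mat n r.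
      (\<forall>j<m. rinner u (A j * v) = 0) \<longrightarrow> u * adj v + v * adj u = 0\<^sub>m n n"
    show "gen_phase_retrievable n r m A"
      unfolding gen_phase_retrievable_def
    proof (intro ballI impI)
      fix x y assume xy: "x \<in> carrier_mat n r" "y \<in> carrier_mat n r" "beta_map m A x = beta_map m A y"
      define u v where "u = (1/2) \<cdot>\<^sub>m (x + y)" and "v = (1/2) \<cdot>\<^sub>m (x - y)"
      have uv: "u \<in> carrier_mat n r" "v \<in> carrier_mat n r" and xy': "x = u + v" "y = u - v"
        using xy(1,2) unfolding u_def v_def
        by (auto simp: minus_carrier_mat field_simps)
      show "x * adj x = y * adj y"
        using g uv beta[OF uv] outer_polarization[OF uv] xy(3) unfolding xy' by blast
    qed
  qed
qed

text \<open>Multiplying \<open>U * adj W + W * adj U = 0\<close> by \<open>U\<close> on the right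
  and using \<open>adj U * U = 1\<close> gives \<open>W = U * K\<close> for
  \<open>K = - (adj W * U)\<close>. Then also \<open>K = adj U * W\<close>, and comparing the two
  forms of \<open>K\<close> shows \<open>adj K = - K\<close>.\<close>

lemma skew_factor_iff:
  assumes U: "orthonormal_cols n r U" and W: "W \<in> carrier_mat n r"
  shows "(\<exists>K. skew_hermitian_mat r K \<and> W = U * K) \<longleftrightarrow> U * adj W + W * adj U = 0\<^sub>m n n"
proof
  note Uc = orthonormal_colsD[OF U]
  assume "\<exists>K. skew_hermitian_mat r K \<and> W = U * K"
  then obtain K where K: "K \<in> carrier_mat r r" "adj K = - K" "W = U * K"
    using skew_hermitian_matD by blast
  have "U * adj W = U * (- K * adj U)"
    unfolding K(3) using Uc K(1,2) by (simp add: adj_mult)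
  also have "\<dots> = - (U * K * adj U)"
    using Uc K(1) by (simp add: assoc_mult_mat[of U n r K r "adj U" n])
  finally show "U * adj W + W * adj U = 0\<^sub>m n n"
    unfolding K(3)
    using uminus_l_inv_mat[OF mult_carrier_mat[OF mult_carrier_mat[OF Uc(1) K(1)] adj_carrier[OF Uc(1)]]]
    by simp
next
  note Uc = orthonormal_colsD[OF U]
  assume e: "U * adj W + W * adj U = 0\<^sub>m n n"
  define K where "K = - (adj W * U)"
  have Kc: "K \<in> carrier_mat r r" "adj W * U \<in> carrier_mat r r" "adj U * W \<in> carrier_mat r r"
    using Uc W by (auto simp: K_def)
  have "W = W * (adj U * U)" using Uc W by simp
  also have "\<dots> = (W * adj U) * U" using Uc W by (simp add: assoc_mult_mat[of W n r "adj U" n U r])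
  also have "W * adj U = - (U * adj W)"
  proof (rule eq_matI)
    fix i j assume "i < dim_row (- (U * adj W))" "j < dim_col (- (U * adj W))"
    then have ij: "i < n" "j < n" using Uc W by auto
    then have "(U * adj W) $$ (i,j) + (W * adj U) $$ (i,j) = 0"
      using arg_cong[OF e, of "\<lambda>M. M $$ (i,j)"] Uc W by (simp del: index_mult_mat(1))
    then show "(W * adj U) $$ (i,j) = (- (U * adj W)) $$ (i,j)"
      using ij Uc W by (simp add: eq_neg_iff_add_eq_0 add.commute del: index_mult_mat(1))
  qed (use Uc W in auto)
  also have "- (U * adj W) * U = U * K"
    unfolding K_def using Uc W by (simp add: assoc_mult_mat[of U n r "adj W" n U r])
  finally have WK: "W = U * K" .
  have "adj U * W = K"
    unfolding WK using Uc Kc by (simp add: assoc_mult_mat[of "adj U" r n U r K r, symmetric])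
  moreover have "adj K = - (adj U * W)"
    unfolding K_def using Uc W by (simp add: adj_uminus adj_mult[of _ r n _ r])
  ultimately have "skew_hermitian_mat r K" using Kc by (simp add: skew_hermitian_mat_def)
  then show "\<exists>K. skew_hermitian_mat r K \<and> W = U * K" using WK by blast
qed

text \<open>For Hermitian \<open>A j\<close> the matrices \<open>U * K\<close> with skew-Hermitian
  \<open>K\<close> are always orthogonal to the \<open>A j * U\<close>. The reverse inclusion,
  demanded here, links phase retrievability to the matrix conditions.\<close>

definition separates_modulo_skew :: "nat \<Rightarrow> nat \<Rightarrow> nat \<Rightarrow> (nat \<Rightarrow> complex mat) \<Rightarrow> complex mat \<Rightarrow> bool" where
  "separates_modulo_skew n r m A U \<longleftrightarrow> (\<forall>W \<in> carrier_mat n r.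
     (\<forall>j<m. rinner (A j * U) W = 0) \<longrightarrow> (\<exists>K. skew_hermitian_mat r K \<and> W = U * K))"

lemma gen_phase_retrievable_iff_separates:
  assumes herm: "\<forall>j<m. hermitian_mat n (A j)" and "r \<le> n"
  shows "gen_phase_retrievable n r m A \<longleftrightarrow>
    (\<forall>U. orthonormal_cols n r U \<longrightarrow> separates_modulo_skew n r m A U)"
proof
  assume g: "gen_phase_retrievable n r m A"
  show "\<forall>U. orthonormal_cols n r U \<longrightarrow> separates_modulo_skew n r m A U"
    unfolding separates_modulo_skew_def
  proof (intro allI ballI impI)
    fix U W assume U: "orthonormal_cols n r U" and W: "W \<in> carrier_mat n r"
      and 0: "\<forall>j<m. rinner (A j * U) W = 0"
    have "\<forall>j<m. rinner U (A j * W) = 0"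
      using 0 herm rinner_hermitian_shift[OF _ orthonormal_colsD(1)[OF U] W] by simp
    then show "\<exists>K. skew_hermitian_mat r K \<and> W = U * K"
      using g orthonormal_colsD(1)[OF U] W
      unfolding gen_phase_retrievable_iff[OF herm] skew_factor_iff[OF U W] by blast
  qed
next
  assume s: "\<forall>U. orthonormal_cols n r U \<longrightarrow> separates_modulo_skew n r m A U"
  show "gen_phase_retrievable n r m A"
    unfolding gen_phase_retrievable_iff[OF herm]
  proof (intro ballI impI)
    fix u v assume uv: "u \<in> carrier_mat n r" "v \<in> carrier_mat n r" and 0: "\<forall>j<m. rinner u (A j * v) = 0"
    obtain U R where U: "orthonormal_cols n r U" and R: "R \<in> carrier_mat r r" and u: "u = U * R"
      using qr_decomposition[OF uv(1) \<open>r \<le> n\<close>] by blast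
    note Uc = orthonormal_colsD(1)[OF U]
    \<comment> \<open>The factor \<open>R\<close> moves from \<open>u\<close> to \<open>v\<close>:
      \<open>rinner (A j * U) W = rinner (A j * u) v\<close>, while
      \<open>U * adj W = u * adj v\<close>.\<close>
    define W where "W = v * adj R"
    have W: "W \<in> carrier_mat n r" using uv R by (auto simp: W_def)
    have "rinner (A j * U) W = 0" if "j < m" for j
    proof -
      have H: "hermitian_mat n (A j)" using herm that by blast
      note Ac = hermitian_matD(1)[OF H]
      have "rinner (A j * U) W = rinner (A j * U * R) v"
        unfolding W_def using rinner_mult_right[of "A j * U" n r R r v] Ac Uc R uv by simp
      also have "A j * U * R = A j * u"
        unfolding u using Ac Uc R by (rule assoc_mult_mat)
      also have "rinner (A j * u) v = 0"
        using rinner_hermitian_shift[OF H uv] 0 that by simp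
      finally show ?thesis .
    qed
    then have "U * adj W + W * adj U = 0\<^sub>m n n"
      using s U W unfolding separates_modulo_skew_def skew_factor_iff[OF U W, symmetric] by blast
    moreover have "U * adj W = u * adj v"
      unfolding u W_def using Uc R uv(2) by (simp add: adj_mult[of v n r "adj R" r] assoc_mult_mat[of U n r R r "adj v" n])
    moreover have "W * adj U = v * adj u"
      unfolding u W_def using Uc R uv(2) by (simp add: adj_mult[of U n r R r] assoc_mult_mat[of v n r "adj R" r "adj U" n])
    ultimately show "u * adj v + v * adj u = 0\<^sub>m n n" by simp
  qed
qed

text \<open>Moving \<open>K\<close> and then \<open>L\<close> across the inner product returns the
  same quantity with a minus sign. For orthonormal \<open>U\<close>, the \<open>U * K\<close> are
  the tangent directions of its orbit under right multiplication by unitary matrices.\<close>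

lemma rinner_skew_direction:
  assumes "hermitian_mat n L" "U \<in> carrier_mat n r" "skew_hermitian_mat r K"
  shows "rinner (L * U) (U * K) = 0"
proof -
  note c = hermitian_matD[OF assms(1)] skew_hermitian_matD[OF assms(3)] assms(2)
  have "rinner (L * U) (U * K) = rinner (U * K) (L * U)"
    by (rule rinner_commute[of _ n r]) (use c in auto)
  also have "\<dots> = rinner U (L * U * adj K)"
    by (rule rinner_mult_right) (use c in auto)
  also have "L * U * adj K = - (L * (U * K))"
    using c by simp
  also have "rinner U (- (L * (U * K))) = - rinner U (L * (U * K))"
    by (rule rinner_uminus_right[of _ n r]) (use c in auto)
  also have "rinner U (L * (U * K)) = rinner (L * U) (U * K)"
    by (rule rinner_hermitian_shift[symmetric, of n _ _ r]) (use c assms in auto)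
  finally show ?thesis by simp
qed

section \<open>The null space of \<open>Qhat\<close>\<close>

lemma smult_mult_mat_vec_eq_0_iff:
  fixes G :: "real mat"
  assumes "G \<in> carrier_mat d d" "x \<in> carrier_vec d" "k \<noteq> 0"
  shows "(k \<cdot>\<^sub>m G) *\<^sub>v x = 0\<^sub>v d \<longleftrightarrow> G *\<^sub>v x = 0\<^sub>v d"
proof -
  have "((k \<cdot>\<^sub>m G) *\<^sub>v x) $ i = k * (G *\<^sub>v x) $ i" if "i < d" for i
    using that assms by simp
  then show ?thesis using assms by (auto simp: vec_eq_iff simp del: index_mult_mat_vec)
qed

lemma minus_mat_eq_0D:
  fixes X :: "'a::group_add mat"
  assumes "X \<in> carrier_mat p q" "Y \<in> carrier_mat p q" "X - Y = 0\<^sub>m p q"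
  shows "X = Y"
proof (rule eq_matI)
  fix i j assume ij: "i < dim_row Y" "j < dim_col Y"
  have "(X - Y) $$ (i,j) = 0" unfolding assms(3) using ij assms(2) by simp
  then show "X $$ (i,j) = Y $$ (i,j)" using ij by simp
qed (use assms in auto)

text \<open>Since \<open>mu\<close> preserves inner products, equal images make \<open>X - Y\<close>
  orthogonal to itself.\<close>

lemma mu_inj:
  assumes "X \<in> carrier_mat p q" "Y \<in> carrier_mat p q" "mu X = mu Y"
  shows "X = Y"
proof -
  have "rinner X X = rinner X Y" "rinner Y X = rinner Y Y"
    using assms dot_list_mu[of _ p q] by metis+
  then have "rinner (X - Y) (X - Y) = 0"
    using assms minus_carrier_mat[OF assms(2), of X]
    by (simp add: rinner_minus_right[of _ p q] rinner_minus_left[of _ p q])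
  then have "X - Y = 0\<^sub>m p q"
    using rinner_self_eq_0 minus_carrier_mat[OF assms(2)] by blast
  then show ?thesis by (rule minus_mat_eq_0D[OF assms(1,2)])
qed

text \<open>Every real vector of this length is some \<open>mu W\<close>, and \<open>mu\<close>
  carries \<open>rinner\<close> to the dot product, so the kernel of the Gram matrix can be read on
  matrices.\<close>

lemma null_space_Qhat:
  assumes herm: "\<forall>j<m. hermitian_mat n (A j)" and z: "z \<in> carrier_mat n r"
  shows "null_space (Qhat m A z) =
    {vec_of_list (mu W) | W. W \<in> carrier_mat n r \<and> (\<forall>j<m. rinner (A j * z) W = 0)}"
proof -
  let ?D = "2 * n * r"
  have Az: "A j * z \<in> carrier_mat n r" if "j < m" for j
    using herm that z hermitian_matD(1)[of n "A j"] by auto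
  have *: "Qhat m A z *\<^sub>v vec_of_list (mu W) = 0\<^sub>v ?D \<longleftrightarrow> (\<forall>j<m. rinner (A j * z) W = 0)"
    if W: "W \<in> carrier_mat n r" for W
  proof -
    have "vec_of_list (mu W) \<in> carrier_vec ?D"
      using length_mu[OF W] by (simp add: carrier_dim_vec)
    then have "Qhat m A z *\<^sub>v vec_of_list (mu W) = 0\<^sub>v ?D \<longleftrightarrow>
      gram_mat ?D m (\<lambda>j. mu (A j * z)) *\<^sub>v vec_of_list (mu W) = 0\<^sub>v ?D"
      unfolding Qhat_eq_gram_mat[OF herm z] by (intro smult_mult_mat_vec_eq_0_iff) auto
    also have "\<dots> \<longleftrightarrow> (\<forall>j<m. dot_list (mu (A j * z)) (mu W) = 0)"
      by (rule gram_mat_kernel) (use length_mu Az W in auto)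
    also have "\<dots> \<longleftrightarrow> (\<forall>j<m. rinner (A j * z) W = 0)"
      using dot_list_mu[OF Az W] by auto
    finally show ?thesis .
  qed
  have dim: "dim_row (Qhat m A z) = ?D" "dim_col (Qhat m A z) = ?D"
    unfolding Qhat_eq_gram_mat[OF herm z] by (auto simp: gram_mat_def)
  show ?thesis
  proof (intro equalityI subsetI)
    fix v assume "v \<in> null_space (Qhat m A z)"
    then have v: "v \<in> carrier_vec ?D" "Qhat m A z *\<^sub>v v = 0\<^sub>v ?D"
      by (auto simp: null_space_def dim)
    obtain W where W: "W \<in> carrier_mat n r" "mu W = list_of_vec v"
      using mu_surj[of "list_of_vec v" n r] v(1) by auto
    then have "v = vec_of_list (mu W)" by (simp add: vec_list)
    then show "v \<in> {vec_of_list (mu W) | W. W \<in> carrier_mat n r \<and> (\<forall>j<m. rinner (A j * z) W = 0)}"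
      using *[OF W(1)] v(2) W(1) by blast
  next
    fix v assume "v \<in> {vec_of_list (mu W) | W. W \<in> carrier_mat n r \<and> (\<forall>j<m. rinner (A j * z) W = 0)}"
    then obtain W where W: "v = vec_of_list (mu W)" "W \<in> carrier_mat n r" "\<forall>j<m. rinner (A j * z) W = 0"
      by blast
    have "v \<in> carrier_vec ?D"
      using length_mu[OF W(2)] by (simp add: W(1) carrier_dim_vec)
    moreover have "Qhat m A z *\<^sub>v v = 0\<^sub>v ?D"
      unfolding W(1) using *[OF W(2)] W(3) by blast
    ultimately show "v \<in> null_space (Qhat m A z)" by (simp add: null_space_def dim)
  qed
qed

text \<open>\<open>Vz z\<close> lies in the null space by \<open>rinner_skew_direction\<close>;
  injectivity of \<open>mu\<close> translates the other inclusion back to matrices.\<close>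

lemma null_space_Qhat_eq_Vz_iff:
  assumes herm: "\<forall>j<m. hermitian_mat n (A j)" and z: "z \<in> carrier_mat n r"
  shows "null_space (Qhat m A z) = Vz z \<longleftrightarrow> separates_modulo_skew n r m A z"
proof
  assume e: "null_space (Qhat m A z) = Vz z"
  show "separates_modulo_skew n r m A z"
    unfolding separates_modulo_skew_def
  proof (intro ballI impI)
    fix W assume W: "W \<in> carrier_mat n r" "\<forall>j<m. rinner (A j * z) W = 0"
    then have "vec_of_list (mu W) \<in> Vz z"
      unfolding e[symmetric] null_space_Qhat[OF herm z] by blast
    then obtain K where K: "vec_of_list (mu W) = vec_of_list (mu (z * K))" "skew_hermitian_mat r K"
      using z by (auto simp: Vz_def)
    then have "mu W = mu (z * K)" by (metis list_vec)
    then have "W = z * K"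
      using mu_inj[OF W(1)] z skew_hermitian_matD(1)[OF K(2)] by simp
    then show "\<exists>K. skew_hermitian_mat r K \<and> W = z * K" using K(2) by blast
  qed
next
  assume s: "separates_modulo_skew n r m A z"
  show "null_space (Qhat m A z) = Vz z"
  proof (intro equalityI subsetI)
    fix v assume "v \<in> null_space (Qhat m A z)"
    then obtain W where W: "v = vec_of_list (mu W)" "W \<in> carrier_mat n r" "\<forall>j<m. rinner (A j * z) W = 0"
      unfolding null_space_Qhat[OF herm z] by blast
    then obtain K where "skew_hermitian_mat r K" "W = z * K"
      using s unfolding separates_modulo_skew_def by blast
    then show "v \<in> Vz z" using W(1) z by (auto simp: Vz_def)
  next
    fix v assume "v \<in> Vz z"
    then obtain K where K: "v = vec_of_list (mu (z * K))" "skew_hermitian_mat r K"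
      using z by (auto simp: Vz_def)
    have "z * K \<in> carrier_mat n r" using z skew_hermitian_matD(1)[OF K(2)] by simp
    moreover have "\<forall>j<m. rinner (A j * z) (z * K) = 0"
      using rinner_skew_direction[OF _ z K(2)] herm by blast
    ultimately show "v \<in> null_space (Qhat m A z)"
      unfolding null_space_Qhat[OF herm z] K(1) by blast
  qed
qed

section \<open>Compressions and invertibility of \<open>Qmat\<close>\<close>

lemma hermitian_compression:
  assumes "hermitian_mat n L" "U \<in> carrier_mat n r"
  shows "hermitian_mat r (adj U * L * U)"
proof -
  note L = hermitian_matD[OF assms(1)] and U = assms(2)
  have LU: "adj U * L \<in> carrier_mat r n" by (rule mult_carrier_mat[OF adj_carrier[OF U] L(1)])
  have "adj (adj U * L * U) = adj U * (L * U)"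
    unfolding adj_mult[OF LU U] adj_mult[OF adj_carrier[OF U] L(1)] using L(2) by simp
  also have "\<dots> = adj U * L * U"
    by (rule assoc_mult_mat[OF adj_carrier[OF U] L(1) U, symmetric])
  finally show ?thesis
    using mult_carrier_mat[OF LU U] by (simp add: hermitian_mat_def)
qed

text \<open>Left multiplication by \<open>adj U1\<close> and \<open>adj U2\<close> moves to the
  other argument. This turns pairings with the vectors that define \<open>Qmat\<close> into pairings
  with the matrices \<open>A j * U1\<close>.\<close>

lemma rinner_compression:
  assumes L: "L \<in> carrier_mat n n" and U1: "U1 \<in> carrier_mat n r" and U2: "U2 \<in> carrier_mat n s"
    and G: "G \<in> carrier_mat r r" and Y: "Y \<in> carrier_mat s r"
  shows "rinner (adj U1 * L * U1) G + rinner (adj U2 * L * U1) Y = rinner (L * U1) (U1 * G + U2 * Y)"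
proof -
  have "rinner (adj U1 * L * U1) G = rinner (L * U1) (U1 * G)"
    using rinner_mult_left[of "adj U1" r n "L * U1" r G] assms
    by (simp add: assoc_mult_mat[of "adj U1" r n L n U1 r])
  moreover have "rinner (adj U2 * L * U1) Y = rinner (L * U1) (U2 * Y)"
    using rinner_mult_left[of "adj U2" s n "L * U1" r Y] assms
    by (simp add: assoc_mult_mat[of "adj U2" s n L n U1 r])
  ultimately show ?thesis
    using rinner_add_right[of "L * U1" n r "U1 * G" "U2 * Y"] assms by simp
qed

lemma dot_list_tau_mu:
  assumes "hermitian_mat r H" "hermitian_mat r G" "B \<in> carrier_mat s r" "Y \<in> carrier_mat s r"
  shows "dot_list (tau H @ mu B) (tau G @ mu Y) = rinner H G + rinner B Y"
  using assms dot_list_tau[OF assms(1,2)] dot_list_mu[OF assms(3,4)]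
  by (simp add: dot_list_append length_tau[of _ r] hermitian_matD(1))

lemma length_tau_mu:
  assumes "hermitian_mat r H" "B \<in> carrier_mat s r"
  shows "length (tau H @ mu B) = r\<^sup>2 + 2 * s * r"
  using assms by (simp add: length_tau[of _ r] length_mu[of _ s r] hermitian_matD(1))

lemma Qmat_eq_gram_mat:
  assumes herm: "\<forall>j<m. hermitian_mat n (A j)" and U1: "U1 \<in> carrier_mat n r" and U2: "U2 \<in> carrier_mat n s"
  shows "Qmat m A U1 U2 = gram_mat (r\<^sup>2 + 2 * s * r) m (\<lambda>j. tau (adj U1 * A j * U1) @ mu (adj U2 * A j * U1))"
proof -
  have "length (tau (adj U1 * A j * U1) @ mu (adj U2 * A j * U1)) = r\<^sup>2 + 2 * s * r" if "j < m" for j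
    using herm that U1 U2 hermitian_matD(1)[of n "A j"]
    by (intro length_tau_mu hermitian_compression) auto
  then show ?thesis
    using U1 U2 by (intro eq_matI) (auto simp: Qmat_def gram_mat_def outer_def Let_def intro!: sum.cong)
qed

text \<open>A kernel vector encodes a Hermitian \<open>G\<close> and a matrix \<open>Y\<close> such
  that \<open>W = U1 * G + U2 * Y\<close> is orthogonal to every \<open>A j * U1\<close>. Hence
  \<open>W = U1 * K\<close> with \<open>K\<close> skew-Hermitian. Comparing components,
  \<open>Y\<close> vanishes and \<open>G = K\<close> is both Hermitian and skew-Hermitian, so
  zero.\<close>

lemma invertible_Qmat:
  assumes herm: "\<forall>j<m. hermitian_mat n (A j)" and U1: "U1 \<in> carrier_mat n r" and U2: "U2 \<in> carrier_mat n s"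
    and n: "n = r + s" and U: "unitary_mat n (hcat U1 U2)" and sep: "separates_modulo_skew n r m A U1"
  shows "invertible_mat (Qmat m A U1 U2)"
proof -
  let ?d = "r\<^sup>2 + 2 * s * r"
  let ?v = "\<lambda>j. tau (adj U1 * A j * U1) @ mu (adj U2 * A j * U1)"
  note V = unitary_hcatD[OF U1 U2 n U]
  have B: "hermitian_mat r (adj U1 * A j * U1)" and C: "adj U2 * A j * U1 \<in> carrier_mat s r"
    and Ac: "A j \<in> carrier_mat n n" if "j < m" for j
    using herm that U1 U2 hermitian_matD(1)[of n "A j"] hermitian_compression[of n "A j" U1 r] by auto
  show ?thesis
    unfolding Qmat_eq_gram_mat[OF herm U1 U2] invertible_mat_iff_kernel[OF gram_mat_carrier]
  proof (intro ballI impI)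
    fix x assume x: "x \<in> carrier_vec ?d" "gram_mat ?d m ?v *\<^sub>v x = 0\<^sub>v ?d"
    define xs where "xs = list_of_vec x"
    have len: "length xs = ?d" and xs: "x = vec_of_list xs" using x(1) by (auto simp: xs_def vec_list)
    obtain G where G: "hermitian_mat r G" "tau G = take (r\<^sup>2) xs"
      using tau_surj[of "take (r\<^sup>2) xs" r] len by auto
    obtain Y where Y: "Y \<in> carrier_mat s r" "mu Y = drop (r\<^sup>2) xs"
      using mu_surj[of "drop (r\<^sup>2) xs" s r] len by auto
    have xs': "xs = tau G @ mu Y" using G Y by simp
    note Gc = hermitian_matD(1)[OF G(1)]
    define W where "W = U1 * G + U2 * Y"
    have Wc: "W \<in> carrier_mat n r" using U1 U2 Gc Y by (auto simp: W_def)
    have "\<forall>j<m. dot_list (?v j) xs = 0"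
      using x(2) gram_mat_kernel[of m ?v ?d xs] length_tau_mu[OF B C] len unfolding xs by blast
    then have "\<forall>j<m. rinner (A j * U1) W = 0"
      unfolding xs' W_def using dot_list_tau_mu[OF B G(1) C Y(1)] rinner_compression[OF Ac U1 U2 Gc Y(1)] by simp
    then obtain K where K: "skew_hermitian_mat r K" "W = U1 * K"
      using sep Wc unfolding separates_modulo_skew_def by blast
    note Kc = skew_hermitian_matD(1)[OF K(1)]
    have "adj U1 * W = G"
      unfolding W_def using U1 U2 Gc Y(1) V
      by (simp add: mult_add_distrib_mat[of _ r n _ r] assoc_mult_mat[of "adj U1" r n U1 r G r, symmetric]
        assoc_mult_mat[of "adj U1" r n U2 s Y r, symmetric])
    moreover have "adj U1 * W = K"
      unfolding K(2) using U1 Kc V by (simp add: assoc_mult_mat[of "adj U1" r n U1 r K r, symmetric])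
    ultimately have "rinner G G = 0" using rinner_skew_hermitian_mat[OF G(1) K(1)] by simp
    moreover have "adj U2 * W = Y"
      unfolding W_def using U1 U2 Gc Y(1) V
      by (simp add: mult_add_distrib_mat[of _ s n _ r] assoc_mult_mat[of "adj U2" s n U1 r G r, symmetric]
        assoc_mult_mat[of "adj U2" s n U2 s Y r, symmetric])
    moreover have "adj U2 * W = 0\<^sub>m s r"
      unfolding K(2) using U1 U2 Kc V by (simp add: assoc_mult_mat[of "adj U2" s n U1 r K r, symmetric])
    ultimately have "rinner G G = 0" "Y = 0\<^sub>m s r" by simp_all
    then have "dot_list xs xs = 0"
      unfolding xs' dot_list_tau_mu[OF G(1,1) Y(1,1)] by simp
    then have "\<forall>i<?d. xs ! i = 0"
      unfolding dot_list_nth[OF refl] len by (subst (asm) sum_nonneg_eq_0_iff) auto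
    then show "x = 0\<^sub>v ?d" using len by (intro eq_vecI) (auto simp: xs vec_of_list_index)
  qed
qed

section \<open>Real combinations and the span condition\<close>

lemma lincomb_carrier [simp]: "lincomb n m c A \<in> carrier_mat n n"
  by (simp add: lincomb_def)

lemma hermitian_lincomb:
  assumes "\<forall>j<m. hermitian_mat n (A j)"
  shows "hermitian_mat n (lincomb n m c A)"
proof -
  have "cnj (A j $$ (b,a)) = A j $$ (a,b)" if "j < m" "a < n" "b < n" for j a b
    using assms that hermitian_matD[of n "A j"] adj_index[of a "A j" b] by simp
  then show ?thesis
    unfolding hermitian_mat_def by (auto simp: lincomb_def intro!: sum.cong)
qed

lemma lincomb_mult:
  assumes "\<forall>j<m. hermitian_mat n (A j)" "U \<in> carrier_mat n r"
  shows "lincomb n m c A * U = mat n r (\<lambda>ab. \<Sum>j<m. complex_of_real (c j) * (A j * U) $$ ab)"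
proof (rule eq_matI)
  fix a b assume "a < dim_row (mat n r (\<lambda>ab. \<Sum>j<m. complex_of_real (c j) * (A j * U) $$ ab))"
    "b < dim_col (mat n r (\<lambda>ab. \<Sum>j<m. complex_of_real (c j) * (A j * U) $$ ab))"
  then have ab: "a < n" "b < r" by auto
  have "(lincomb n m c A * U) $$ (a,b) = (\<Sum>l<n. lincomb n m c A $$ (a,l) * U $$ (l,b))"
    by (rule index_mult_sum[OF lincomb_carrier assms(2) ab])
  also have "\<dots> = (\<Sum>l<n. \<Sum>j<m. complex_of_real (c j) * (A j $$ (a,l) * U $$ (l,b)))"
    using ab by (simp add: lincomb_def sum_distrib_right mult.assoc)
  also have "\<dots> = (\<Sum>j<m. \<Sum>l<n. complex_of_real (c j) * (A j $$ (a,l) * U $$ (l,b)))"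
    by (rule sum.swap)
  also have "\<dots> = (\<Sum>j<m. complex_of_real (c j) * (A j * U) $$ (a,b))"
    using assms(1) index_mult_sum[OF hermitian_matD(1) assms(2) ab]
    by (intro sum.cong refl) (simp add: sum_distrib_left del: index_mult_mat(1))
  finally show "(lincomb n m c A * U) $$ (a,b) =
      mat n r (\<lambda>ab. \<Sum>j<m. complex_of_real (c j) * (A j * U) $$ ab) $$ (a,b)"
    using ab by simp
qed (use assms in \<open>auto simp: lincomb_def\<close>)

lemma rinner_lincomb:
  assumes "\<forall>j<m. hermitian_mat n (A j)" "U \<in> carrier_mat n r" "X \<in> carrier_mat n r"
  shows "rinner (lincomb n m c A * U) X = (\<Sum>j<m. c j * rinner (A j * U) X)"
proof -
  have c: "A j * U \<in> carrier_mat n r" if "j < m" for j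
    using assms that hermitian_matD(1)[of n "A j"] by auto
  have "rinner (lincomb n m c A * U) X = rinner X (lincomb n m c A * U)"
    by (rule rinner_commute[of _ n r]) (use assms in \<open>auto intro: mult_carrier_mat[OF lincomb_carrier]\<close>)
  also have "\<dots> = (\<Sum>j<m. c j * rinner X (A j * U))"
    unfolding lincomb_mult[OF assms(1,2)] by (rule rinner_combination[OF assms(3) c])
  finally show ?thesis using rinner_commute[OF c assms(3)] by simp
qed

lemma real_span_AU_eq:
  assumes "\<forall>j<m. hermitian_mat n (A j)" "U \<in> carrier_mat n r"
  shows "real_span_AU m A U = range (\<lambda>c. lincomb n m c A * U)"
  unfolding lincomb_mult[OF assms] real_span_AU_def using assms(2) by auto

text \<open>Solving \<open>Q x = b\<close> with \<open>Q = \<Sum>j. v\<^sub>j v\<^sub>j\<^sup>T\<close> expresses \<open>b\<close> as the combination of the \<open>v\<^sub>j\<close>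
  with coefficients \<open>v\<^sub>j\<^sup>T x\<close>.\<close>
lemma lincomb_compression_surj:
  assumes herm: "\<forall>j<m. hermitian_mat n (A j)" and U1: "U1 \<in> carrier_mat n r" and U2: "U2 \<in> carrier_mat n s"
    and inv: "invertible_mat (Qmat m A U1 U2)" and H: "hermitian_mat r H" and B: "B \<in> carrier_mat s r"
  shows "\<exists>c. adj U1 * lincomb n m c A * U1 = H \<and> adj U2 * lincomb n m c A * U1 = B"
proof -
  let ?d = "r\<^sup>2 + 2 * s * r"
  let ?v = "\<lambda>j. tau (adj U1 * A j * U1) @ mu (adj U2 * A j * U1)"
  define b where "b = tau H @ mu B"
  have Bj: "hermitian_mat r (adj U1 * A j * U1)" and Cj: "adj U2 * A j * U1 \<in> carrier_mat s r"
    and Ac: "A j \<in> carrier_mat n n" if "j < m" for j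
    using herm that U1 U2 hermitian_matD(1)[of n "A j"] hermitian_compression[of n "A j" U1 r] by auto
  have lenb: "length b = ?d" unfolding b_def by (rule length_tau_mu[OF H B])
  obtain R where R: "gram_mat ?d m ?v * R = 1\<^sub>m ?d" "R * gram_mat ?d m ?v = 1\<^sub>m (dim_row R)"
    using inv unfolding Qmat_eq_gram_mat[OF herm U1 U2] invertible_mat_def inverts_mat_def
    by (auto simp: gram_mat_def)
  have "dim_row R = ?d" "dim_col R = ?d"
    using arg_cong[OF R(1), of dim_col] arg_cong[OF R(2), of dim_col] by (auto simp: gram_mat_def)
  then have Rc: "R \<in> carrier_mat ?d ?d" by auto
  have bc: "vec_of_list b \<in> carrier_vec ?d" using lenb by (simp add: carrier_dim_vec)
  define xs where "xs = list_of_vec (R *\<^sub>v vec_of_list b)"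
  have lenx: "length xs = ?d" using Rc by (simp add: xs_def)
  have "gram_mat ?d m ?v *\<^sub>v vec_of_list xs = (gram_mat ?d m ?v * R) *\<^sub>v vec_of_list b"
    unfolding xs_def vec_list using Rc bc by (simp add: assoc_mult_mat_vec[of _ ?d ?d _ ?d])
  then have Qx: "gram_mat ?d m ?v *\<^sub>v vec_of_list xs = vec_of_list b"
    using R(1) bc by simp
  define c where "c j = dot_list (?v j) xs" for j
  have b: "b ! a = (\<Sum>j<m. c j * ?v j ! a)" if "a < ?d" for a
    using gram_mat_mult_vec[of m ?v ?d xs a, OF length_tau_mu[OF Bj Cj] lenx that] lenb that
    unfolding Qx c_def by (simp add: vec_of_list_index mult.commute)
  let ?L = "lincomb n m c A"
  have LU: "?L * U1 \<in> carrier_mat n r" using U1 by (rule mult_carrier_mat[OF lincomb_carrier])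
  \<comment> \<open>The compressions of \<open>?L\<close> are compared with \<open>H\<close> and
    \<open>B\<close> through inner products with arbitrary \<open>G\<close> and \<open>Y\<close>, so
    that only the isometry property of \<open>tau\<close> and \<open>mu\<close> enters.\<close>
  have main: "rinner (adj U1 * ?L * U1) G + rinner (adj U2 * ?L * U1) Y = rinner H G + rinner B Y"
    if G: "hermitian_mat r G" and Y: "Y \<in> carrier_mat s r" for G Y
  proof -
    note Gc = hermitian_matD(1)[OF G]
    let ?e = "tau G @ mu Y"
    have lene: "length ?e = ?d" by (rule length_tau_mu[OF G Y])
    have "rinner H G + rinner B Y = dot_list b ?e"
      unfolding b_def using dot_list_tau_mu[OF H G B Y] by simp
    also have "\<dots> = (\<Sum>a<?d. (\<Sum>j<m. c j * ?v j ! a) * ?e ! a)"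
      using lenb lene b by (simp add: dot_list_nth)
    also have "\<dots> = (\<Sum>j<m. \<Sum>a<?d. c j * (?v j ! a * ?e ! a))"
      by (subst sum.swap) (simp add: sum_distrib_right mult.assoc)
    also have "\<dots> = (\<Sum>j<m. c j * dot_list (?v j) ?e)"
    proof (intro sum.cong refl)
      fix j assume "j \<in> {..<m}"
      then have "length (?v j) = ?d" using length_tau_mu[OF Bj Cj] by blast
      then show "(\<Sum>a<?d. c j * (?v j ! a * ?e ! a)) = c j * dot_list (?v j) ?e"
        using lene by (simp only: dot_list_nth sum_distrib_left)
    qed
    also have "\<dots> = (\<Sum>j<m. c j * rinner (A j * U1) (U1 * G + U2 * Y))"
      using dot_list_tau_mu[OF Bj G Cj Y] rinner_compression[OF Ac U1 U2 Gc Y] by simp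
    also have "\<dots> = rinner (?L * U1) (U1 * G + U2 * Y)"
      by (rule rinner_lincomb[OF herm U1, symmetric]) (use U1 U2 Gc Y in auto)
    also have "\<dots> = rinner (adj U1 * ?L * U1) G + rinner (adj U2 * ?L * U1) Y"
      using rinner_compression[OF lincomb_carrier U1 U2 Gc Y] by simp
    finally show ?thesis ..
  qed
  \<comment> \<open>The differences themselves are admissible test matrices, as \<open>E\<close> is
    Hermitian; testing on them leaves two nonnegative terms with sum zero.\<close>
  define E where "E = adj U1 * ?L * U1 - H"
  define F where "F = adj U2 * ?L * U1 - B"
  have LUc: "adj U2 * ?L * U1 \<in> carrier_mat s r"
    using U1 U2 by (meson adj_carrier lincomb_carrier mult_carrier_mat)
  have HL: "hermitian_mat r (adj U1 * ?L * U1)"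
    by (rule hermitian_compression[OF hermitian_lincomb[OF herm] U1])
  have E: "hermitian_mat r E"
    unfolding E_def hermitian_mat_def
    using hermitian_matD[OF HL] hermitian_matD[OF H] by (simp add: minus_carrier_mat adj_minus[of _ r r])
  have F: "F \<in> carrier_mat s r" unfolding F_def using B by (rule minus_carrier_mat)
  note Ec = hermitian_matD(1)[OF E]
  have "rinner E E + rinner F F = 0"
    using main[OF E F] rinner_minus_left[OF Ec hermitian_matD(1)[OF HL] hermitian_matD(1)[OF H]]
      rinner_minus_left[OF F LUc B] unfolding E_def[symmetric] F_def[symmetric] by simp
  then have "rinner E E = 0" "rinner F F = 0"
    using rinner_self_nonneg[OF Ec] rinner_self_nonneg[OF F] by auto
  then have EF: "E = 0\<^sub>m r r" "F = 0\<^sub>m s r" using rinner_self_eq_0 Ec F by blast+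
  show ?thesis
    using minus_mat_eq_0D[OF hermitian_matD(1)[OF HL] hermitian_matD(1)[OF H] EF(1)[unfolded E_def]]
      minus_mat_eq_0D[OF LUc B EF(2)[unfolded F_def]] by blast
qed

text \<open>The witness is \<open>(H - adj H) / 2\<close>, which leaves the Hermitian part
  \<open>(H + adj H) / 2\<close>.\<close>

lemma exists_skew_hermitian_part:
  assumes "H \<in> carrier_mat r r"
  obtains K where "skew_hermitian_mat r K" "hermitian_mat r (H - K)"
proof
  let ?K = "mat r r (\<lambda>(i,j). (H $$ (i,j) - cnj (H $$ (j,i))) / 2)"
  show "skew_hermitian_mat r ?K"
    unfolding skew_hermitian_mat_def by (auto simp: field_simps)
  show "hermitian_mat r (H - ?K)"
    unfolding hermitian_mat_def using assms by (auto simp: minus_carrier_mat field_simps)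
qed

text \<open>Real combinations of the \<open>A j\<close> are Hermitian, which gives one inclusion.
  For the other, orthogonality to all \<open>U1 * K\<close> forces \<open>adj U1 * X\<close> to be
  Hermitian, so \<open>surj\<close> supplies a combination with the same two compressions as
  \<open>X\<close>, and these determine \<open>X\<close>.\<close>

lemma real_span_AU_eq_orth_compl:
  assumes herm: "\<forall>j<m. hermitian_mat n (A j)" and U1: "U1 \<in> carrier_mat n r" and U2: "U2 \<in> carrier_mat n s"
    and n: "n = r + s" and U: "unitary_mat n (hcat U1 U2)"
    and surj: "\<And>H B. hermitian_mat r H \<Longrightarrow> B \<in> carrier_mat s r \<Longrightarrow>
      \<exists>c. adj U1 * lincomb n m c A * U1 = H \<and> adj U2 * lincomb n m c A * U1 = B"
  shows "real_span_AU m A U1 = orth_compl n r {U1 * K | K. skew_hermitian_mat r K}"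
  unfolding real_span_AU_eq[OF herm U1]
proof (intro equalityI subsetI)
  fix X assume "X \<in> range (\<lambda>c. lincomb n m c A * U1)"
  then obtain c where X: "X = lincomb n m c A * U1" by blast
  have "X \<in> carrier_mat n r" unfolding X using U1 by (rule mult_carrier_mat[OF lincomb_carrier])
  then show "X \<in> orth_compl n r {U1 * K | K. skew_hermitian_mat r K}"
    using rinner_skew_direction[OF hermitian_lincomb[OF herm] U1] unfolding orth_compl_def X by blast
next
  note V = unitary_hcatD[OF U1 U2 n U]
  fix X assume "X \<in> orth_compl n r {U1 * K | K. skew_hermitian_mat r K}"
  then have orth: "rinner X (U1 * K) = 0" if "skew_hermitian_mat r K" for K
    using that by (auto simp: orth_compl_def)
  have Xc: "X \<in> carrier_mat n r"
    using \<open>X \<in> orth_compl n r _\<close> by (simp add: orth_compl_def)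
  let ?H = "adj U1 * X"
  have Hc: "?H \<in> carrier_mat r r" by (rule mult_carrier_mat[OF adj_carrier[OF U1] Xc])
  obtain K where K: "skew_hermitian_mat r K" "hermitian_mat r (?H - K)"
    using exists_skew_hermitian_part[OF Hc] by blast
  note Kc = skew_hermitian_matD(1)[OF K(1)]
  \<comment> \<open>The skew-Hermitian part \<open>K\<close> is orthogonal to \<open>?H\<close> by
    assumption and to the Hermitian \<open>?H - K\<close>, hence to itself.\<close>
  have "rinner ?H K = 0"
    using orth[OF K(1)] rinner_mult_left[of "adj U1" r n X r K] U1 Xc Kc by simp
  moreover have "rinner ?H K - rinner K K = 0"
    using rinner_skew_hermitian_mat[OF K(2,1)] rinner_minus_left[OF Kc Hc Kc] by simp
  ultimately have "K = 0\<^sub>m r r" using rinner_self_eq_0[OF Kc] by simp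
  moreover have "Y - 0\<^sub>m r r = Y" if "Y \<in> carrier_mat r r" for Y :: "complex mat"
    using that by (intro eq_matI) auto
  ultimately have "hermitian_mat r ?H" using K(2) Hc by simp
  then obtain c where c: "adj U1 * lincomb n m c A * U1 = ?H" "adj U2 * lincomb n m c A * U1 = adj U2 * X"
    using surj[OF _ mult_carrier_mat[OF adj_carrier[OF U2] Xc]] by blast
  define Z where "Z = lincomb n m c A * U1"
  have Zc: "Z \<in> carrier_mat n r" unfolding Z_def using U1 by (rule mult_carrier_mat[OF lincomb_carrier])
  have Z: "adj U1 * Z = adj U1 * X" "adj U2 * Z = adj U2 * X"
    using c U1 U2 unfolding Z_def
    by (simp_all add: assoc_mult_mat[OF _ lincomb_carrier U1, of _ r] assoc_mult_mat[OF _ lincomb_carrier U1, of _ s])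
  have decomp: "M = U1 * (adj U1 * M) + U2 * (adj U2 * M)" if M: "M \<in> carrier_mat n r" for M
  proof -
    have "M = (U1 * adj U1 + U2 * adj U2) * M" using V(5) M by simp
    also have "\<dots> = U1 * (adj U1 * M) + U2 * (adj U2 * M)"
      using U1 U2 M by (simp add: add_mult_distrib_mat[of _ n n] assoc_mult_mat[of U1 n r "adj U1" n M r]
        assoc_mult_mat[of U2 n s "adj U2" n M r])
    finally show ?thesis .
  qed
  have "X = Z" using decomp[OF Xc] decomp[OF Zc] Z by simp
  then show "X \<in> range (\<lambda>c. lincomb n m c A * U1)" unfolding Z_def by blast
qed

text \<open>Subtract \<open>U * K\<close> from \<open>W\<close>, where \<open>K\<close> is such that
  \<open>adj U * W - K\<close> is Hermitian. The rest \<open>D\<close> is orthogonal to all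
  \<open>U * K'\<close>, so it is a real combination of the \<open>A j * U\<close> and therefore
  orthogonal to \<open>W\<close>. Being orthogonal to \<open>W\<close> and to \<open>U * K\<close>,
  it is orthogonal to itself.\<close>

lemma separates_modulo_skew_if_span:
  assumes herm: "\<forall>j<m. hermitian_mat n (A j)" and U: "orthonormal_cols n r U"
    and span: "real_span_AU m A U = orth_compl n r {U * K | K. skew_hermitian_mat r K}"
  shows "separates_modulo_skew n r m A U"
  unfolding separates_modulo_skew_def
proof (intro ballI impI)
  note Uc = orthonormal_colsD[OF U]
  fix W assume W: "W \<in> carrier_mat n r" and 0: "\<forall>j<m. rinner (A j * U) W = 0"
  let ?H = "adj U * W"
  have Hc: "?H \<in> carrier_mat r r" by (rule mult_carrier_mat[OF adj_carrier[OF Uc(1)] W])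
  obtain K where K: "skew_hermitian_mat r K" "hermitian_mat r (?H - K)"
    using exists_skew_hermitian_part[OF Hc] by blast
  note Kc = skew_hermitian_matD(1)[OF K(1)]
  have UK: "U * K \<in> carrier_mat n r" using Uc Kc by simp
  define D where "D = W - U * K"
  have D: "D \<in> carrier_mat n r" unfolding D_def using UK by (rule minus_carrier_mat)
  have UD: "adj U * D = ?H - K"
    unfolding D_def using Uc Kc W
    by (simp add: mult_minus_distrib_mat[of _ r n _ r] assoc_mult_mat[of "adj U" r n U r K r, symmetric])
  have orth: "rinner D (U * K') = 0" if K': "skew_hermitian_mat r K'" for K'
    using rinner_mult_left[of "adj U" r n D r K'] Uc D skew_hermitian_matD(1)[OF K']
      rinner_skew_hermitian_mat[OF K(2) K'] unfolding UD by simp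
  then have "D \<in> real_span_AU m A U" unfolding span orth_compl_def using D by blast
  then obtain c where "D = lincomb n m c A * U" unfolding real_span_AU_eq[OF herm Uc(1)] by blast
  then have "rinner D W = 0" using rinner_lincomb[OF herm Uc(1) W] 0 by simp
  then have "rinner D D = 0"
    using orth[OF K(1)] rinner_minus_right[OF D W UK] unfolding D_def[symmetric] by simp
  then have "D = 0\<^sub>m n r" by (rule rinner_self_eq_0[OF D])
  then have "W = U * K" unfolding D_def by (rule minus_mat_eq_0D[OF W UK])
  then show "\<exists>K. skew_hermitian_mat r K \<and> W = U * K" using K(1) by blast
qed

section \<open>Equivalence of the five conditions\<close>

theorem theorem4p14:
  fixes n r m :: nat and A :: "nat \<Rightarrow> complex mat"
  assumes "1 \<le> r" and "r \<le> n"
    and herm: "\<forall>j<m. hermitian_mat n (A j)"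
    and frame: "is_frame n r m A"
  shows
   "(gen_phase_retrievable n r m A \<longleftrightarrow>
       (\<forall>U1 U2. U1 \<in> carrier_mat n r \<and> U2 \<in> carrier_mat n (n - r) \<and> unitary_mat n (hcat U1 U2)
          \<longrightarrow> invertible_mat (Qmat m A U1 U2))) \<and>
    (gen_phase_retrievable n r m A \<longleftrightarrow>
       (\<forall>z. orthonormal_cols n r z \<longrightarrow> null_space (Qhat m A z) = Vz z)) \<and>
    (gen_phase_retrievable n r m A \<longleftrightarrow>
       (\<forall>U1 U2 H B. U1 \<in> carrier_mat n r \<and> U2 \<in> carrier_mat n (n - r) \<and> unitary_mat n (hcat U1 U2)
          \<and> hermitian_mat r H \<and> B \<in> carrier_mat (n - r) r
          \<longrightarrow> (\<exists>c :: nat \<Rightarrow> real. adj U1 * lincomb n m c A * U1 = H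
                                 \<and> adj U2 * lincomb n m c A * U1 = B))) \<and>
    (gen_phase_retrievable n r m A \<longleftrightarrow>
       (\<forall>U1. orthonormal_cols n r U1 \<longrightarrow>
          real_span_AU m A U1 =
            orth_compl n r {U1 * K | K. skew_hermitian_mat r K}))"
    (is "(?i \<longleftrightarrow> ?ii) \<and> (?i \<longleftrightarrow> ?iii) \<and> (?i \<longleftrightarrow> ?iv) \<and> (?i \<longleftrightarrow> ?v)")
proof -
  have n: "n = r + (n - r)" using \<open>r \<le> n\<close> by simp
  note sep = gen_phase_retrievable_iff_separates[OF herm \<open>r \<le> n\<close>]
  \<comment> \<open>Conditions (i) and (iii) are compared separately at each \<open>z\<close>; the
    remaining ones form the cycle (i), (ii), (iv), (v), (i).\<close>
  have i_iii: "?i \<longleftrightarrow> ?iii"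
    unfolding sep using null_space_Qhat_eq_Vz_iff[OF herm] orthonormal_colsD(1) by blast
  have i_ii: ?ii if ?i
  proof (intro allI impI, elim conjE)
    fix U1 U2 assume U1: "U1 \<in> carrier_mat n r" and U2: "U2 \<in> carrier_mat n (n - r)"
      and U: "unitary_mat n (hcat U1 U2)"
    have "orthonormal_cols n r U1"
      using U1 unitary_hcatD(1)[OF U1 U2 n U] by (simp add: orthonormal_cols_def)
    then have "separates_modulo_skew n r m A U1" using that unfolding sep by blast
    then show "invertible_mat (Qmat m A U1 U2)" by (rule invertible_Qmat[OF herm U1 U2 n U])
  qed
  have ii_iv: ?iv if ?ii
  proof (intro allI impI, elim conjE)
    fix U1 U2 H B :: "complex mat" assume U1: "U1 \<in> carrier_mat n r" and U2: "U2 \<in> carrier_mat n (n - r)"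
      and U: "unitary_mat n (hcat U1 U2)" and HB: "hermitian_mat r H" "B \<in> carrier_mat (n - r) r"
    have "invertible_mat (Qmat m A U1 U2)" using that U1 U2 U by blast
    then show "\<exists>c. adj U1 * lincomb n m c A * U1 = H \<and> adj U2 * lincomb n m c A * U1 = B"
      by (rule lincomb_compression_surj[OF herm U1 U2 _ HB])
  qed
  have iv_v: ?v if ?iv
  proof (intro allI impI)
    fix U1 assume o: "orthonormal_cols n r U1"
    \<comment> \<open>Condition (v) mentions \<open>U1\<close> alone, so a unitary completion is
      chosen before (iv) can be applied.\<close>
    obtain U2 where U2: "U2 \<in> carrier_mat n (n - r)" "unitary_mat n (hcat U1 U2)"
      using orthonormal_cols_complete[OF o \<open>r \<le> n\<close>] by blast
    note U1 = orthonormal_colsD(1)[OF o]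
    show "real_span_AU m A U1 = orth_compl n r {U1 * K | K. skew_hermitian_mat r K}"
      by (rule real_span_AU_eq_orth_compl[OF herm U1 U2(1) n U2(2)]) (use that U1 U2 in blast)
  qed
  have v_i: ?i if ?v
    unfolding sep using separates_modulo_skew_if_span[OF herm] that by blast
  show ?thesis using i_iii i_ii ii_iv iv_v v_i by argo
qed

end
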